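(* Let $r\ge1$ and assume that for each $p\in D$, $f_p\in C^r(\mathbb R)$ and $f_p'(t)\ge0$ for all $t\in\mathbb R$. For $(\gamma,\varphi)\in\mathbb R_+^E\times\mathbb R^{\partial D}$ let $u_{\gamma,\varphi}$ be the solution of the semilinear Dirichlet problem with boundary datum $\varphi$, let $F_\gamma(\varphi)$ be its Neumann data, and let $\Lambda_\gamma(\varphi)=D_\varphi F_\gamma(\varphi)$ be the Dirichlet-to-Neumann map of the linearized problem at $u_{\gamma,\varphi}$. Then the pair $(u_{\gamma,\varphi},\gamma)$ is uniquely determined by the triple $(\Lambda_\gamma(\varphi),F_\gamma(\varphi),\varphi)$: if $\gamma,\gamma'\in\mathbb R_+^E$ and $\varphi\in\mathbb R^{\partial D}$ satisfy $\Lambda_\gamma(\varphi)=\Lambda_{\gamma'}(\varphi)$ and $F_\gamma(\varphi)=F_{\gamma'}(\varphi)$, then $\gamma=\gamma'$ and $u_{\gamma,\varphi}=u_{\gamma',\varphi}$. Moreover, the reconstruction is implemented locally by a $C^{r-1}$ map: for every $(\gamma_0,\varphi_0)\in\mathbb R_+^E\times\mathbb R^{\partial D}$ there exist an open neighborhood $\mathcal U\subset\mathbb R^{\partial D\times\partial D}\times\mathbb R^{\partial D}\times\mathbb R^{\partial D}$ of $(\Lambda_{\gamma_0}(\varphi_0),F_{\gamma_0}(\varphi_0),\varphi_0)$ and a $C^{r-1}$ map $\mathcal R:\mathcal U\to\mathbb R^{\overline D}\times\mathbb R_+^E$ such that $\mathcal R(\Lambda_\gamma(\varphi),F_\gamma(\varphi),\varphi)=(u_{\gamma,\varphi},\gamma)$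 for every $(\gamma,\varphi)\in\mathbb R_+^E\times\mathbb R^{\partial D}$ whose triple $(\Lambda_\gamma(\varphi),F_\gamma(\varphi),\varphi)$ lies in $\mathcal U$.
   Context: Square lattice. Fix an integer $n\ge1$. Let $D=\{(i,j): i,j=1,\dots,n\}$ (interior nodes), $\partial D=\{(0,j),(n+1,j),(i,0),(i,n+1): i,j=1,\dots,n\}$ (boundary nodes), $\overline D=D\cup\partial D$. The edge set $E$ consists of the unordered pairs $\{p,q\}$ with $p=(i,j)\in D$, $q=(i',j')\in\overline D$, $|i-i'|+|j-j'|=1$. For $p\in\overline D$, $N(p)=\{q\in\overline D:\{p,q\}\in E\}$. For a finite set $S$, $\mathbb R^S$ is the space of real functions on $S$; $\mathbb R_+=(0,\infty)$. A conductivity is $\gamma\in\mathbb R_+^E$, with $\gamma_{pq}=\gamma_{qp}$ its value on $\{p,q\}$. Direct problem. $f=(f_p)_{p\in D}$ is a fixed known family of functions $\mathbb R\to\mathbb R$. Given $\varphi\in\mathbb R^{\partial D}$, the semilinear Dirichlet problem is: find $u\in\mathbb R^{\overline D}$ with $\sum_{q\in N(p)}\gamma_{pq}(u_q-u_p)=f_p(u_p)$ for all $p\in D$ and $u_p=\varphi_p$ for all $p\in\partial D$. If each $f_p$ is continuous and non-decreasing there is a unique solution $u_{\gamma,\varphi}$. The nonlinear Dirichlet-to-Neumann (DtN) map $F_\gamma:\mathbb R^{\partial D}\to\mathbb R^{\partial D}$ is $(F_\gamma(\varphi))_p=\sum_{q\in N(p)}\gamma_{pq}(u_p-u_q)$,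 $p\in\partial D$, with $u=u_{\gamma,\varphi}$. Linearized problem. With $u=u_{\gamma,\varphi}$ and $h\in\mathbb R^{\partial D}$, find $w\in\mathbb R^{\overline D}$ with $\sum_{q\in N(p)}\gamma_{pq}(w_q-w_p)=f_p'(u_p)w_p$ for $p\in D$ and $w_p=h_p$ for $p\in\partial D$. The linearized DtN map $\Lambda_\gamma(\varphi)$ sends $h$ to the Neumann data $\bigl(\sum_{q\in N(p)}\gamma_{pq}(w_p-w_q)\bigr)_{p\in\partial D}$; it equals the Fréchet derivative $D_\varphi F_\gamma(\varphi)$ and is viewed as a matrix in $\mathbb R^{\partial D\times\partial D}$. *)

theory Defs
  imports "HOL-Analysis.Analysis"
begin

section \<open>The square lattice\<close>

definition lattice_interior :: "nat \<Rightarrow> (int \<times> int) set" where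
  "lattice_interior n = {1..int n} \<times> {1..int n}"

definition lattice_boundary :: "nat \<Rightarrow> (int \<times> int) set" where
  "lattice_boundary n =
     (\<Union>k\<in>{1..int n}. {(0, k), (int n + 1, k), (k, 0), (k, int n + 1)})"

text \<open>
  The size of the lattice is \<open>n = CARD('n)\<close>, so that \<open>n \<ge> 1\<close> is arbitrary and automatic, and the
  spaces of real functions on the nodes, the boundary nodes and the edges are the Euclidean spaces
  \<open>real ^ 'n node\<close>, \<open>real ^ 'n bnode\<close> and \<open>real ^ 'n edge\<close>.
\<close>

lemma lattice_interior_one: "(1, 1) \<in> lattice_interior CARD('n::finite)"
  and lattice_boundary_one: "(0, 1) \<in> lattice_boundary CARD('n::finite)"
proof -
  have "1 \<le> CARD('n)"
    by (simp add: Suc_leI)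
  then have "1 \<le> int CARD('n)"
    by linarith
  then show "(1, 1) \<in> lattice_interior CARD('n)" "(0, 1) \<in> lattice_boundary CARD('n)"
    by (auto simp: lattice_interior_def lattice_boundary_def)
qed

typedef 'n node = "lattice_interior CARD('n::finite) \<union> lattice_boundary CARD('n)"
  using lattice_interior_one by blast

instance node :: (finite) finite
proof
  have "finite (lattice_interior CARD('a) \<union> lattice_boundary CARD('a))"
    by (simp add: lattice_interior_def lattice_boundary_def)
  then have "finite (range (Rep_node :: 'a node \<Rightarrow> _))"
    using type_definition.Rep_range[OF type_definition_node] by metis
  then show "finite (UNIV :: 'a node set)"
    by (rule finite_imageD) (simp add: inj_on_def Rep_node_inject)
qed

definition inner_nodes :: "'n::finite node set" where
  "inner_nodes = {p. Rep_node p \<in> lattice_interior CARD('n)}"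

definition boundary_nodes :: "'n::finite node set" where
  "boundary_nodes = {p. Rep_node p \<in> lattice_boundary CARD('n)}"

definition adjacent :: "'n::finite node \<Rightarrow> 'n node \<Rightarrow> bool" where
  "adjacent p q \<longleftrightarrow>
     (case (Rep_node p, Rep_node q) of ((i, j), (i', j')) \<Rightarrow> \<bar>i - i'\<bar> + \<bar>j - j'\<bar> = 1)"

definition edges :: "'n::finite node set set" where
  "edges = {{p, q} |p q. p \<in> inner_nodes \<and> adjacent p q}"

definition neighbours :: "'n::finite node \<Rightarrow> 'n node set" where
  "neighbours p = {q. {p, q} \<in> edges}"

typedef 'n bnode = "boundary_nodes :: 'n::finite node set"
proof -
  have "Abs_node (0, 1) \<in> (boundary_nodes :: 'n node set)"
    by (simp add: boundary_nodes_def Abs_node_inverse lattice_boundary_one)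
  then show ?thesis by blast
qed

instance bnode :: (finite) finite
proof
  have "finite (range (Rep_bnode :: 'a bnode \<Rightarrow> _))"
    by (rule finite)
  then show "finite (UNIV :: 'a bnode set)"
    by (rule finite_imageD) (simp add: inj_on_def Rep_bnode_inject)
qed

typedef 'n edge = "edges :: 'n::finite node set set"
proof -
  let ?p = "Abs_node (1, 1) :: 'n node" and ?q = "Abs_node (0, 1) :: 'n node"
  have "?p \<in> inner_nodes" "adjacent ?p ?q"
    by (simp_all add: inner_nodes_def adjacent_def Abs_node_inverse
        lattice_interior_one lattice_boundary_one)
  then have "{?p, ?q} \<in> edges"
    unfolding edges_def by blast
  then show ?thesis by blast
qed

instance edge :: (finite) finite
proof
  have "finite (range (Rep_edge :: 'a edge \<Rightarrow> _))"
    by (rule finite)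
  then show "finite (UNIV :: 'a edge set)"
    by (rule finite_imageD) (simp add: inj_on_def Rep_edge_inject)
qed

section \<open>Dirichlet problems and Dirichlet-to-Neumann maps\<close>

definition conductivities :: "(real ^ 'n::finite edge) set" where
  "conductivities = {\<gamma>. \<forall>e. \<gamma> $ e > 0}"

text \<open>
  The value \<open>cond \<gamma> p q\<close> is meaningful only if \<open>{p, q}\<close> is an edge; below, \<open>q\<close> always ranges
  over \<open>neighbours p\<close>.
\<close>

definition cond :: "real ^ 'n::finite edge \<Rightarrow> 'n node \<Rightarrow> 'n node \<Rightarrow> real" where
  "cond \<gamma> p q = \<gamma> $ Abs_edge {p, q}"

definition neumann_data :: "real ^ 'n::finite edge \<Rightarrow> real ^ 'n node \<Rightarrow> real ^ 'n bnode" where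
  "neumann_data \<gamma> u =
     (\<chi> b. \<Sum>q\<in>neighbours (Rep_bnode b). cond \<gamma> (Rep_bnode b) q * (u $ Rep_bnode b - u $ q))"

text \<open>
  The family \<open>f\<close> of nonlinearities is indexed by all nodes, but only its members at inner nodes
  are ever used.
\<close>

definition semilinear_solution ::
  "('n::finite node \<Rightarrow> real \<Rightarrow> real) \<Rightarrow> real ^ 'n edge \<Rightarrow> real ^ 'n bnode \<Rightarrow> real ^ 'n node \<Rightarrow> bool"
where
  "semilinear_solution f \<gamma> \<phi> u \<longleftrightarrow>
     (\<forall>p\<in>inner_nodes. (\<Sum>q\<in>neighbours p. cond \<gamma> p q * (u $ q - u $ p)) = f p (u $ p)) \<and>
     (\<forall>b. u $ Rep_bnode b = \<phi> $ b)"

definition solution ::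
  "('n::finite node \<Rightarrow> real \<Rightarrow> real) \<Rightarrow> real ^ 'n edge \<Rightarrow> real ^ 'n bnode \<Rightarrow> real ^ 'n node" where
  "solution f \<gamma> \<phi> = (THE u. semilinear_solution f \<gamma> \<phi> u)"

definition dtn_map ::
  "('n::finite node \<Rightarrow> real \<Rightarrow> real) \<Rightarrow> real ^ 'n edge \<Rightarrow> real ^ 'n bnode \<Rightarrow> real ^ 'n bnode" where
  "dtn_map f \<gamma> \<phi> = neumann_data \<gamma> (solution f \<gamma> \<phi>)"

text \<open>The linearized problem at \<open>u\<close> is the case \<open>f\<^sub>p(t) = f\<^sub>p'(u\<^sub>p) t\<close> of the semilinear problem.\<close>

definition linearized_solution ::
  "('n::finite node \<Rightarrow> real \<Rightarrow> real) \<Rightarrow> real ^ 'n edge \<Rightarrow> real ^ 'n bnode \<Rightarrow> real ^ 'n bnode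
     \<Rightarrow> real ^ 'n node" where
  "linearized_solution f \<gamma> \<phi> h = solution (\<lambda>p t. deriv (f p) (solution f \<gamma> \<phi> $ p) * t) \<gamma> h"

definition linearized_dtn ::
  "('n::finite node \<Rightarrow> real \<Rightarrow> real) \<Rightarrow> real ^ 'n edge \<Rightarrow> real ^ 'n bnode
     \<Rightarrow> real ^ 'n bnode ^ 'n bnode" where
  "linearized_dtn f \<gamma> \<phi> = matrix (\<lambda>h. neumann_data \<gamma> (linearized_solution f \<gamma> \<phi> h))"

section \<open>Functions of class \<open>C\<^sup>k\<close>\<close>

text \<open>
  For open \<open>S\<close>. As the domain is finite-dimensional, the Frechet derivative is of class \<open>C\<^sup>k\<close> as a
  map into the space of linear maps iff it is so when evaluated at each fixed vector.
\<close>

primrec Ck_on :: "nat \<Rightarrow> ('a::euclidean_space \<Rightarrow> 'b::euclidean_space) \<Rightarrow> 'a set \<Rightarrow> bool" where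
  "Ck_on 0 g S \<longleftrightarrow> continuous_on S g"
| "Ck_on (Suc k) g S \<longleftrightarrow>
     (\<forall>x\<in>S. g differentiable (at x)) \<and> (\<forall>v. Ck_on k (\<lambda>x. frechet_derivative g (at x) v) S)"

end

theory Submission
  imports Defs
begin

text \<open>
  The Dirichlet-to-Neumann matrix \<open>\<Lambda>\<close> determines solutions of the linearized problem with prescribed
  Cauchy data on the left side and Dirichlet data on the bottom and top sides. With zero data except
  for the value 1 at one top node \<open>(m, n + 1)\<close>, the solution vanishes below the diagonal through
  that node, whatever the potential \<open>f\<^sub>p'(u\<^sub>p)\<close> is, and is nonzero at every node of the diagonal. Its
  Neumann datum at \<open>(m, n + 1)\<close> is the conductivity of the boundary edge there, and the equations
  along the staircase below the diagonal determine the edges of the next layer one after the other.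
  Then the semilinear equation, started from the Neumann data \<open>F\<close>, gives \<open>u\<close> on the next diagonal and
  hence the potential needed for the following step. Sweeping from two opposite corners covers the
  lattice. All steps are \<open>C\<^sup>r\<^sup>-\<^sup>1\<close> operations on the data: arithmetic, Cramer's rule,
  \<open>f\<^sub>p\<close> and \<open>f\<^sub>p'\<close>, so one reconstruction map works near all measurements simultaneously.
\<close>

section \<open>Calculus of \<open>C\<^sup>k\<close> functions\<close>

text \<open>Openness enters because a derivative sees a whole neighbourhood: functions equal on an
  open set have equal derivatives at each of its points.\<close>

lemma Ck_on_cong:
  assumes "open S" "\<And>x. x \<in> S \<Longrightarrow> g x = h x" "Ck_on k g S"
  shows "Ck_on k h S"
  using assms(2,3)
proof (induction k arbitrary: g h)
  case 0
  then show ?case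
    by (simp cong: continuous_on_cong)
next
  case (Suc k)
  have der: "(h has_derivative frechet_derivative g (at x)) (at x)" if "x \<in> S" for x
  proof -
    have "(g has_derivative frechet_derivative g (at x)) (at x)"
      using Suc.prems(2) that by (simp add: frechet_derivative_works)
    then show ?thesis
      by (rule has_derivative_transform_within_open[OF _ assms(1) that]) (use Suc.prems(1) in auto)
  qed
  have "frechet_derivative g (at x) = frechet_derivative h (at x)" if "x \<in> S" for x
    using frechet_derivative_at[OF der[OF that]] .
  then have "Ck_on k (\<lambda>x. frechet_derivative h (at x) v) S" for v
    using Suc.IH[of "\<lambda>x. frechet_derivative g (at x) v"] Suc.prems(2) by simp
  then show ?case
    using der by (auto simp: differentiable_def)
qed

text \<open>Derivatives are unique, so any explicit formula may replace the chosen
  \<open>frechet_derivative\<close>. The closure properties below all use this form.\<close>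

lemma Ck_on_SucI:
  assumes "open S" "\<And>x. x \<in> S \<Longrightarrow> (g has_derivative g' x) (at x)"
    and "\<And>v. Ck_on k (\<lambda>x. g' x v) S"
  shows "Ck_on (Suc k) g S"
proof -
  have "Ck_on k (\<lambda>x. frechet_derivative g (at x) v) S" for v
    using assms(1) _ assms(3)[of v]
    by (rule Ck_on_cong) (metis assms(2) frechet_derivative_at)
  then show ?thesis
    using assms(2) by (auto simp: differentiable_def)
qed

lemma Ck_on_SucD:
  assumes "Ck_on (Suc k) g S"
  shows "x \<in> S \<Longrightarrow> (g has_derivative frechet_derivative g (at x)) (at x)"
    and "Ck_on k (\<lambda>x. frechet_derivative g (at x) v) S"
  using assms by (simp_all add: frechet_derivative_works)

lemma Ck_on_Suc_imp: "Ck_on (Suc k) g S \<Longrightarrow> Ck_on k g S"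
proof (induction k arbitrary: g)
  case 0
  then show ?case
    by (auto intro!: differentiable_imp_continuous_on simp: differentiable_on_def differentiable_at_withinI)
next
  case (Suc k)
  have "Ck_on k (\<lambda>x. frechet_derivative g (at x) v) S" for v
    by (rule Suc.IH) (use Suc.prems in simp)
  then show ?case
    using Suc.prems by simp
qed

lemma Ck_on_subset: "Ck_on k g S \<Longrightarrow> S' \<subseteq> S \<Longrightarrow> Ck_on k g S'"
  by (induction k arbitrary: g) (auto intro: continuous_on_subset)

lemma Ck_on_imp_continuous_on: "Ck_on k g S \<Longrightarrow> continuous_on S g"
proof (induction k)
  case (Suc k)
  then show ?case
    using Ck_on_Suc_imp by blast
qed simp

lemma Ck_on_const: "open S \<Longrightarrow> Ck_on k (\<lambda>x. c) S"
proof (induction k arbitrary: c)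
  case (Suc k)
  show ?case
    by (rule Ck_on_SucI[where g' = "\<lambda>x v. 0"]) (use Suc in auto)
qed auto

lemma Ck_on_linear_compose:
  assumes "open S" "bounded_linear L" "Ck_on k g S"
  shows "Ck_on k (\<lambda>x. L (g x)) S"
  using assms(3)
proof (induction k arbitrary: g)
  case 0
  then show ?case
    using bounded_linear.continuous_on[OF assms(2)] by simp
next
  case (Suc k)
  show ?case
    by (rule Ck_on_SucI[OF assms(1) bounded_linear.has_derivative[OF assms(2) Ck_on_SucD(1)[OF Suc.prems]]])
      (use Suc.IH Ck_on_SucD(2)[OF Suc.prems] in auto)
qed

lemma Ck_on_linear:
  assumes "open S" "bounded_linear L"
  shows "Ck_on k L S"
proof (cases k)
  case 0
  then show ?thesis
    using assms(2) by (simp add: linear_continuous_on)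
next
  case (Suc m)
  show ?thesis
    unfolding Suc by (rule Ck_on_SucI[OF assms(1) bounded_linear_imp_has_derivative[OF assms(2)]])
      (simp add: Ck_on_const assms(1))
qed

lemma Ck_on_add:
  assumes "open S" "Ck_on k g S" "Ck_on k h S"
  shows "Ck_on k (\<lambda>x. g x + h x) S"
  using assms(2,3)
proof (induction k arbitrary: g h)
  case 0
  then show ?case
    by (simp add: continuous_on_add)
next
  case (Suc k)
  show ?case
    by (rule Ck_on_SucI[OF assms(1) has_derivative_add[OF Ck_on_SucD(1)[OF Suc.prems(1)]
            Ck_on_SucD(1)[OF Suc.prems(2)]]])
      (use Suc.IH Ck_on_SucD(2)[OF Suc.prems(1)] Ck_on_SucD(2)[OF Suc.prems(2)] in auto)
qed

lemma Ck_on_sum: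
  assumes "open S" "\<And>i. i \<in> I \<Longrightarrow> Ck_on k (g i) S"
  shows "Ck_on k (\<lambda>x. \<Sum>i\<in>I. g i x) S"
  using assms(2)
  by (induction I rule: infinite_finite_induct) (auto intro: Ck_on_add Ck_on_const assms(1))

lemma Ck_on_mult:
  fixes g h :: "'a::euclidean_space \<Rightarrow> real"
  assumes "open S" "Ck_on k g S" "Ck_on k h S"
  shows "Ck_on k (\<lambda>x. g x * h x) S"
  using assms(2,3)
proof (induction k arbitrary: g h)
  case 0
  then show ?case
    by (simp add: continuous_on_mult)
next
  case (Suc k)
  show ?case
    by (rule Ck_on_SucI[OF assms(1) has_derivative_mult[OF Ck_on_SucD(1)[OF Suc.prems(1)]
            Ck_on_SucD(1)[OF Suc.prems(2)]]])
      (assumption | intro Ck_on_add Suc.IH assms(1) Suc.prems[THEN Ck_on_SucD(2)]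
        Suc.prems[THEN Ck_on_Suc_imp])+
qed

lemma Ck_on_inverse:
  fixes g :: "'a::euclidean_space \<Rightarrow> real"
  assumes "open S" "Ck_on k g S" "\<And>x. x \<in> S \<Longrightarrow> g x \<noteq> 0"
  shows "Ck_on k (\<lambda>x. inverse (g x)) S"
  using assms(2)
proof (induction k)
  case 0
  then show ?case
    using assms(3) by (simp add: continuous_on_inverse)
next
  case (Suc k)
  \<comment> \<open>The derivative of the inverse contains the inverse itself; the induction
    hypothesis supplies it at the one order lower that is required.\<close>
  have inv: "Ck_on k (\<lambda>x. inverse (g x)) S"
    using Suc Ck_on_Suc_imp by blast
  have "Ck_on k (\<lambda>x. - (inverse (g x) * frechet_derivative g (at x) v * inverse (g x))) S" for v
    by (intro Ck_on_linear_compose[OF assms(1) bounded_linear_minus[OF bounded_linear_ident]]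
        Ck_on_mult assms(1) inv Ck_on_SucD(2)[OF Suc.prems])
  then show ?case
    by (intro Ck_on_SucI[OF assms(1) Deriv.has_derivative_inverse[OF assms(3) Ck_on_SucD(1)[OF Suc.prems]]])
qed

lemma Ck_on_compose_real:
  fixes g :: "real \<Rightarrow> real" and h :: "'a::euclidean_space \<Rightarrow> real"
  assumes "open S" "Ck_on k g UNIV" "Ck_on k h S"
  shows "Ck_on k (\<lambda>x. g (h x)) S"
  using assms(2,3)
proof (induction k arbitrary: g)
  case 0
  then show ?case
    by (auto intro: continuous_on_compose2)
next
  case (Suc k)
  have "Ck_on k (\<lambda>x. frechet_derivative h (at x) v * frechet_derivative g (at (h x)) 1) S" for v
    using Suc.IH[OF Ck_on_SucD(2)[OF Suc.prems(1)] Ck_on_Suc_imp[OF Suc.prems(2)]]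
      Ck_on_SucD(2)[OF Suc.prems(2)] by (intro Ck_on_mult assms(1))
  \<comment> \<open>In the chain rule the derivative of \<open>g\<close> is evaluated at a vector
    that varies with \<open>x\<close>. Linearity pulls this vector out as a factor, leaving
    evaluation at the fixed vector 1.\<close>
  moreover have "frechet_derivative g (at t) c = c * frechet_derivative g (at t) 1" for t c
    using linear_cmul[OF linear_frechet_derivative, of g "at t" c 1] Suc.prems(1) by simp
  then have "(\<lambda>x. frechet_derivative g (at (h x)) (frechet_derivative h (at x) v)) =
      (\<lambda>x. frechet_derivative h (at x) v * frechet_derivative g (at (h x)) 1)" for v
    by blast
  ultimately have "Ck_on k (\<lambda>x. frechet_derivative g (at (h x)) (frechet_derivative h (at x) v)) S" for v
    by simp
  moreover have "((\<lambda>x. g (h x)) has_derivative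
      (\<lambda>v. frechet_derivative g (at (h x)) (frechet_derivative h (at x) v))) (at x)" if "x \<in> S" for x
    using diff_chain_at[OF Ck_on_SucD(1)[OF Suc.prems(2) that] Ck_on_SucD(1)[OF Suc.prems(1)]]
    by (simp add: o_def)
  ultimately show ?case
    by (intro Ck_on_SucI[OF assms(1)])
qed

lemma Ck_on_vec:
  fixes g :: "'a::euclidean_space \<Rightarrow> real ^ 'i::finite"
  assumes "open S" "\<And>i. Ck_on k (\<lambda>x. g x $ i) S"
  shows "Ck_on k g S"
proof -
  have "Ck_on k (\<lambda>x. \<Sum>i\<in>UNIV. g x $ i *\<^sub>R (axis i 1 :: real ^ 'i)) S"
    by (intro Ck_on_sum assms(1) Ck_on_linear_compose[OF assms(1) bounded_linear_scaleR_left] assms(2))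
  moreover have "(\<Sum>i\<in>UNIV. g x $ i *\<^sub>R (axis i 1 :: real ^ 'i)) = g x" for x
    by (simp add: vec_eq_iff axis_def if_distrib cong: if_cong)
  ultimately show ?thesis
    by simp
qed

lemma Ck_on_Pair:
  assumes "open S" "Ck_on k g S" "Ck_on k h S"
  shows "Ck_on k (\<lambda>x. (g x, h x)) S"
proof -
  have "bounded_linear (\<lambda>y::'b. (y, 0::'c))" "bounded_linear (\<lambda>y::'c. (0::'b, y))"
    by (intro bounded_linear_Pair bounded_linear_ident bounded_linear_zero)+
  from Ck_on_add[OF assms(1) Ck_on_linear_compose[OF assms(1) this(1) assms(2)]
      Ck_on_linear_compose[OF assms(1) this(2) assms(3)]]
  show ?thesis
    by simp
qed

text \<open>Here \<open>T\<close> is the measurement, \<open>P\<close> the set of admissible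
  unknowns and \<open>Q\<close> a quantity to be reconstructed. One \<open>\<rho>\<close> serves an
  open neighbourhood of all measured data, so a single statement contains both uniqueness (equal
  data give equal \<open>Q\<close>) and regularity of the reconstruction.\<close>

definition Ck_factors ::
  "nat \<Rightarrow> ('x \<Rightarrow> 'a::euclidean_space) \<Rightarrow> 'x set \<Rightarrow> ('x \<Rightarrow> real) \<Rightarrow> bool" where
  "Ck_factors k T P Q \<longleftrightarrow>
     (\<exists>U \<rho>. open U \<and> T ` P \<subseteq> U \<and> Ck_on k \<rho> U \<and> (\<forall>x\<in>P. \<rho> (T x) = Q x))"

lemma Ck_factorsI:
  "open U \<Longrightarrow> T ` P \<subseteq> U \<Longrightarrow> Ck_on k \<rho> U \<Longrightarrow> (\<And>x. x \<in> P \<Longrightarrow> \<rho> (T x) = Q x) \<Longrightarrow>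
    Ck_factors k T P Q"
  unfolding Ck_factors_def by blast

lemma Ck_factors_cong:
  "(\<And>x. x \<in> P \<Longrightarrow> Q x = Q' x) \<Longrightarrow> Ck_factors k T P Q \<longleftrightarrow> Ck_factors k T P Q'"
  unfolding Ck_factors_def by simp

lemma Ck_factors_const: "Ck_factors k T P (\<lambda>x. c)"
  by (rule Ck_factorsI[of UNIV]) (auto intro: Ck_on_const)

lemma Ck_factors_linear: "bounded_linear L \<Longrightarrow> Ck_factors k T P (\<lambda>x. L (T x))"
  by (rule Ck_factorsI[of UNIV]) (auto intro: Ck_on_linear)

lemma Ck_factors_binary:
  fixes T :: "'x \<Rightarrow> 'a::euclidean_space" and F :: "real \<Rightarrow> real \<Rightarrow> real"
  assumes "Ck_factors k T P Q" "Ck_factors k T P Q'"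
    and op: "\<And>(U :: 'a set) \<rho> \<rho>'. open U \<Longrightarrow> Ck_on k \<rho> U \<Longrightarrow> Ck_on k \<rho>' U \<Longrightarrow> Ck_on k (\<lambda>y. F (\<rho> y) (\<rho>' y)) U"
  shows "Ck_factors k T P (\<lambda>x. F (Q x) (Q' x))"
proof -
  obtain U \<rho> U' \<rho>' where *: "open U" "T ` P \<subseteq> U" "Ck_on k \<rho> U" "\<forall>x\<in>P. \<rho> (T x) = Q x"
    "open U'" "T ` P \<subseteq> U'" "Ck_on k \<rho>' U'" "\<forall>x\<in>P. \<rho>' (T x) = Q' x"
    using assms(1,2) unfolding Ck_factors_def by blast
  have "Ck_on k \<rho> (U \<inter> U')" "Ck_on k \<rho>' (U \<inter> U')"
    using Ck_on_subset[OF *(3)] Ck_on_subset[OF *(7)] by simp_all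
  then show ?thesis
    using * by (intro Ck_factorsI[of "U \<inter> U'" T P k "\<lambda>y. F (\<rho> y) (\<rho>' y)"] op[of "U \<inter> U'" \<rho> \<rho>']) auto
qed

lemma Ck_factors_compose_real:
  assumes "Ck_factors k T P Q" "Ck_on k g UNIV"
  shows "Ck_factors k T P (\<lambda>x. g (Q x))"
  by (rule Ck_factors_binary[OF assms(1,1), of "\<lambda>a b. g a"])
    (rule Ck_on_compose_real[OF _ assms(2)])

lemma Ck_factors_add:
  "Ck_factors k T P Q \<Longrightarrow> Ck_factors k T P Q' \<Longrightarrow> Ck_factors k T P (\<lambda>x. Q x + Q' x)"
  by (rule Ck_factors_binary[where F = "(+)"]) (auto intro: Ck_on_add)

lemma Ck_factors_mult:
  "Ck_factors k T P Q \<Longrightarrow> Ck_factors k T P Q' \<Longrightarrow> Ck_factors k T P (\<lambda>x. Q x * Q' x)"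
  by (rule Ck_factors_binary[where F = "(*)"]) (auto intro: Ck_on_mult)

lemma Ck_factors_minus: "Ck_factors k T P Q \<Longrightarrow> Ck_factors k T P (\<lambda>x. - Q x)"
  using Ck_factors_mult[OF Ck_factors_const[of k T P "-1"]] by simp

lemma Ck_factors_diff:
  "Ck_factors k T P Q \<Longrightarrow> Ck_factors k T P Q' \<Longrightarrow> Ck_factors k T P (\<lambda>x. Q x - Q' x)"
  using Ck_factors_add[of k T P Q "\<lambda>x. - Q' x"] Ck_factors_minus[of k T P Q'] by simp

lemma Ck_factors_inverse:
  assumes "Ck_factors k T P Q" "\<And>x. x \<in> P \<Longrightarrow> Q x \<noteq> 0"
  shows "Ck_factors k T P (\<lambda>x. inverse (Q x))"
proof -
  obtain U \<rho> where *: "open U" "T ` P \<subseteq> U" "Ck_on k \<rho> U" "\<forall>x\<in>P. \<rho> (T x) = Q x"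
    using assms(1) unfolding Ck_factors_def by blast
  \<comment> \<open>Off the image of \<open>P\<close>, \<open>\<rho>\<close> may vanish. Removing
    its zeros keeps the set open and keeps all measured data in it.\<close>
  let ?U = "U \<inter> \<rho> -` (- {0})"
  have "open ?U"
    using * Ck_on_imp_continuous_on by (intro continuous_open_preimage) auto
  moreover have "Ck_on k (\<lambda>y. inverse (\<rho> y)) ?U"
    using calculation * by (intro Ck_on_inverse) (auto intro: Ck_on_subset)
  ultimately show ?thesis
    using * assms(2) by (intro Ck_factorsI[of ?U]) auto
qed

lemma Ck_factors_divide:
  "Ck_factors k T P Q \<Longrightarrow> Ck_factors k T P Q' \<Longrightarrow> (\<And>x. x \<in> P \<Longrightarrow> Q' x \<noteq> 0) \<Longrightarrow>
    Ck_factors k T P (\<lambda>x. Q x / Q' x)"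
  unfolding divide_inverse by (intro Ck_factors_mult Ck_factors_inverse)

lemma Ck_factors_sum:
  "(\<And>i. i \<in> I \<Longrightarrow> Ck_factors k T P (Q i)) \<Longrightarrow> Ck_factors k T P (\<lambda>x. \<Sum>i\<in>I. Q i x)"
  by (induction I rule: infinite_finite_induct) (auto intro: Ck_factors_add Ck_factors_const)

lemma Ck_factors_prod:
  "(\<And>i. i \<in> I \<Longrightarrow> Ck_factors k T P (Q i)) \<Longrightarrow> Ck_factors k T P (\<lambda>x. \<Prod>i\<in>I. Q i x)"
  by (induction I rule: infinite_finite_induct) (auto intro: Ck_factors_mult Ck_factors_const)

lemma Ck_factors_det:
  "(\<And>i j. Ck_factors k T P (\<lambda>x. A x $ i $ j)) \<Longrightarrow> Ck_factors k T P (\<lambda>x. det (A x))"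
  unfolding det_def by (intro Ck_factors_sum Ck_factors_mult Ck_factors_const Ck_factors_prod)

text \<open>Nothing is assumed about how \<open>h\<close> depends on \<open>x\<close>: Cramer's rule
  writes its components as quotients of determinants whose entries already factor.\<close>

lemma Ck_factors_linear_system:
  fixes A :: "'x \<Rightarrow> real ^ 'i::finite ^ 'i"
  assumes "\<And>i j. Ck_factors k T P (\<lambda>x. A x $ i $ j)" "\<And>i. Ck_factors k T P (\<lambda>x. b x $ i)"
    and "\<And>x. x \<in> P \<Longrightarrow> det (A x) \<noteq> 0" "\<And>x. x \<in> P \<Longrightarrow> A x *v h x = b x"
  shows "Ck_factors k T P (\<lambda>x. h x $ i)"
proof -
  have "h x $ i = det (\<chi> l j. if j = i then b x $ l else A x $ l $ j) / det (A x)" if "x \<in> P" for x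
    using cramer[of "A x" "h x" "b x"] assms(3,4)[OF that] by simp
  moreover have "Ck_factors k T P (\<lambda>x. (\<chi> l j. if j = i then b x $ l else A x $ l $ j) $ l $ j)" for l j
    using assms(1,2) by (cases "j = i") simp_all
  then have "Ck_factors k T P
      (\<lambda>x. det (\<chi> l j. if j = i then b x $ l else A x $ l $ j) / det (A x))"
    using assms(1,3) by (intro Ck_factors_divide Ck_factors_det)
  ultimately show ?thesis
    by (simp cong: Ck_factors_cong)
qed

text \<open>Each component comes with its own neighbourhood; there are finitely many, so their
  intersection is still open.\<close>

lemma Ck_factors_vec:
  fixes T :: "'x \<Rightarrow> 'a::euclidean_space" and q :: "'x \<Rightarrow> real ^ 'i::finite"
  assumes "\<And>i. Ck_factors k T P (\<lambda>x. q x $ i)"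
  shows "\<exists>U \<rho>. open U \<and> T ` P \<subseteq> U \<and> Ck_on k \<rho> U \<and> (\<forall>x\<in>P. \<rho> (T x) = q x)"
proof -
  obtain U \<rho> where *: "\<And>i. open (U i)" "\<And>i. T ` P \<subseteq> U i" "\<And>i. Ck_on k (\<rho> i) (U i)"
    "\<And>i x. x \<in> P \<Longrightarrow> \<rho> i (T x) = q x $ i"
    using assms unfolding Ck_factors_def by metis
  let ?U = "\<Inter>i. U i" and ?\<rho> = "\<lambda>y. \<chi> i. \<rho> i y"
  have "open ?U"
    using *(1) by (simp add: open_INT)
  moreover have "Ck_on k ?\<rho> ?U"
    by (rule Ck_on_vec[OF \<open>open ?U\<close>]) (auto intro: Ck_on_subset[OF *(3)])
  moreover have "T ` P \<subseteq> ?U"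
    using *(2) by blast
  moreover have "\<forall>x\<in>P. ?\<rho> (T x) = q x"
    using *(4) by (simp add: vec_eq_iff)
  ultimately show ?thesis
    by blast
qed

lemma deriv_eq_frechet_derivative:
  fixes g :: "real \<Rightarrow> real"
  assumes "g differentiable at t"
  shows "frechet_derivative g (at t) 1 = deriv g t"
proof -
  have "(g has_derivative (*) (deriv g t)) (at t)"
    using assms DERIV_deriv_iff_real_differentiable has_field_derivative_def by blast
  then show ?thesis
    by (simp flip: frechet_derivative_at)
qed

section \<open>Charts of the lattice\<close>

text \<open>The union of the two rectangles is the full square of side \<open>n + 2\<close> without
  its four corners, which are not nodes.\<close>

definition on_grid :: "int \<Rightarrow> int \<Rightarrow> int \<Rightarrow> bool" where
  "on_grid n i j \<longleftrightarrow>
     1 \<le> i \<and> i \<le> n \<and> 0 \<le> j \<and> j \<le> n + 1 \<or> 0 \<le> i \<and> i \<le> n + 1 \<and> 1 \<le> j \<and> j \<le> n"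

text \<open>
  The chart for \<open>s = False\<close> is the point reflection of the one for \<open>s = True\<close>: a sweep from the corner
  \<open>(n + 1, n + 1)\<close> in it is a sweep from the corner \<open>(0, 0)\<close> of the lattice.
\<close>

definition grid_node :: "bool \<Rightarrow> int \<Rightarrow> int \<Rightarrow> 'n::finite node" where
  "grid_node s i j =
     Abs_node (if s then (i, j) else (int CARD('n) + 1 - i, int CARD('n) + 1 - j))"

lemma boundary_nodes_eq: "(boundary_nodes :: 'n::finite node set) = - inner_nodes"
proof -
  have "Rep_node p \<in> lattice_interior CARD('n) \<union> lattice_boundary CARD('n)" for p :: "'n node"
    by (rule Rep_node)
  moreover have "lattice_interior CARD('n) \<inter> lattice_boundary CARD('n) = {}"
    by (auto simp: lattice_interior_def lattice_boundary_def)
  ultimately show ?thesis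
    by (auto simp: inner_nodes_def boundary_nodes_def)
qed

lemma adjacent_commute: "adjacent p q \<longleftrightarrow> adjacent q p"
  by (auto simp: adjacent_def split: prod.splits)

text \<open>The second conjunct matters: consecutive boundary nodes on one side are adjacent lattice
  points, but no edge joins them.\<close>

lemma mem_neighbours_iff:
  "q \<in> neighbours p \<longleftrightarrow> adjacent p q \<and> (p \<in> inner_nodes \<or> q \<in> inner_nodes)"
  unfolding neighbours_def edges_def using adjacent_commute
  by (auto simp: doubleton_eq_iff)

context
  fixes n :: int
  assumes n_def: "n = int CARD('n::finite)"
begin

lemma lattice_size_pos: "n \<ge> 1"
  using n_def zero_less_card_finite[where 'a = 'n] by linarith

lemma on_grid_iff: "on_grid n i j \<longleftrightarrow> (i, j) \<in> lattice_interior CARD('n) \<union> lattice_boundary CARD('n)"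
  using lattice_size_pos n_def
  by (auto simp: on_grid_def lattice_interior_def lattice_boundary_def)

lemma Rep_grid_node:
  assumes "on_grid n i j"
  shows "Rep_node (grid_node s i j :: 'n node) = (if s then (i, j) else (n + 1 - i, n + 1 - j))"
proof -
  have "on_grid n (n + 1 - i) (n + 1 - j)"
    using assms by (auto simp: on_grid_def)
  then show ?thesis
    using assms by (simp add: grid_node_def on_grid_iff Abs_node_inverse flip: n_def)
qed

lemma grid_node_cases:
  obtains i j where "on_grid n i j" "(p :: 'n node) = grid_node s i j"
proof -
  obtain a b where ab: "Rep_node p = (a, b)"
    by (cases "Rep_node p")
  then have on: "on_grid n a b"
    using Rep_node[of p] by (simp add: on_grid_iff)
  let ?i = "if s then a else n + 1 - a" and ?j = "if s then b else n + 1 - b"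
  have on': "on_grid n ?i ?j"
    using on by (auto simp: on_grid_def)
  have "Rep_node p = Rep_node (grid_node s ?i ?j :: 'n node)"
    using Rep_grid_node[OF on', of s] ab by (cases s) simp_all
  then have "p = grid_node s ?i ?j"
    by (simp only: Rep_node_inject)
  with on' show ?thesis
    by (rule that)
qed

lemma grid_node_inject:
  "on_grid n i j \<Longrightarrow> on_grid n i' j' \<Longrightarrow>
    (grid_node s i j :: 'n node) = grid_node s i' j' \<longleftrightarrow> i = i' \<and> j = j'"
  by (auto simp: Rep_grid_node simp flip: Rep_node_inject split: if_splits)

lemma grid_node_inner_iff:
  "on_grid n i j \<Longrightarrow>
    (grid_node s i j :: 'n node) \<in> inner_nodes \<longleftrightarrow> 1 \<le> i \<and> i \<le> n \<and> 1 \<le> j \<and> j \<le> n"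
  by (auto simp: inner_nodes_def Rep_grid_node lattice_interior_def simp flip: n_def)

lemma adjacent_grid_node_iff:
  "on_grid n i j \<Longrightarrow> on_grid n i' j' \<Longrightarrow>
    adjacent (grid_node s i j :: 'n node) (grid_node s i' j') \<longleftrightarrow> \<bar>i - i'\<bar> + \<bar>j - j'\<bar> = 1"
  by (auto simp: adjacent_def Rep_grid_node)

lemma neighbours_inner:
  assumes "1 \<le> i" "i \<le> n" "1 \<le> j" "j \<le> n"
  shows "neighbours (grid_node s i j :: 'n node) =
    {grid_node s (i + 1) j, grid_node s (i - 1) j, grid_node s i (j + 1), grid_node s i (j - 1)}"
    (is "_ = ?N")
proof (rule set_eqI)
  fix q :: "'n node"
  have on: "on_grid n i j" "on_grid n (i + 1) j" "on_grid n (i - 1) j" "on_grid n i (j + 1)"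
    "on_grid n i (j - 1)"
    using assms by (auto simp: on_grid_def)
  obtain i' j' where q: "on_grid n i' j'" "q = grid_node s i' j'"
    by (rule grid_node_cases)
  show "q \<in> neighbours (grid_node s i j) \<longleftrightarrow> q \<in> ?N"
    using on q assms
    by (auto simp: mem_neighbours_iff grid_node_inner_iff adjacent_grid_node_iff grid_node_inject)
qed

text \<open>Since boundary nodes are not joined to each other, only the facing inner node remains. A
  Neumann datum is therefore a single product of a conductivity and a difference of values.\<close>

lemma neighbours_top:
  assumes "1 \<le> i" "i \<le> n"
  shows "neighbours (grid_node s i (n + 1) :: 'n node) = {grid_node s i n}" (is "_ = ?N")
proof (rule set_eqI)
  fix q :: "'n node"
  have on: "on_grid n i (n + 1)" "on_grid n i n"
    using assms by (auto simp: on_grid_def)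
  obtain i' j' where q: "on_grid n i' j'" "q = grid_node s i' j'"
    by (rule grid_node_cases)
  show "q \<in> neighbours (grid_node s i (n + 1)) \<longleftrightarrow> q \<in> ?N"
    using on q assms
    by (auto simp: mem_neighbours_iff grid_node_inner_iff adjacent_grid_node_iff grid_node_inject)
qed

lemma neighbours_left:
  assumes "1 \<le> j" "j \<le> n"
  shows "neighbours (grid_node s 0 j :: 'n node) = {grid_node s 1 j}" (is "_ = ?N")
proof (rule set_eqI)
  fix q :: "'n node"
  have on: "on_grid n 0 j" "on_grid n 1 j"
    using assms by (auto simp: on_grid_def)
  obtain i' j' where q: "on_grid n i' j'" "q = grid_node s i' j'"
    by (rule grid_node_cases)
  show "q \<in> neighbours (grid_node s 0 j) \<longleftrightarrow> q \<in> ?N"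
    using on q assms
    by (auto simp: mem_neighbours_iff grid_node_inner_iff adjacent_grid_node_iff grid_node_inject)
qed

lemma sum_neighbours_inner:
  assumes "1 \<le> i" "i \<le> n" "1 \<le> j" "j \<le> n"
  shows "(\<Sum>q\<in>neighbours (grid_node s i j :: 'n node). F q) =
    F (grid_node s (i + 1) j) + F (grid_node s (i - 1) j) + F (grid_node s i (j + 1)) +
    F (grid_node s i (j - 1))"
proof -
  have "on_grid n (i + 1) j" "on_grid n (i - 1) j" "on_grid n i (j + 1)" "on_grid n i (j - 1)"
    using assms by (auto simp: on_grid_def)
  then show ?thesis
    by (simp add: neighbours_inner[OF assms] grid_node_inject algebra_simps)
qed

text \<open>Edges are defined from an inner end, which leaves four directions. Naming each edge by
  its left or lower end in the chart reduces them to two, matching the indexing by \<open>hc\<close>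
  and \<open>vc\<close> later.\<close>

lemma edge_cases:
  assumes "e \<in> (edges :: 'n node set set)"
  obtains i j where "on_grid n i j" "on_grid n (i + 1) j" "1 \<le> j" "j \<le> n"
      "e = {grid_node s i j, grid_node s (i + 1) j}"
    | i j where "on_grid n i j" "on_grid n i (j + 1)" "1 \<le> i" "i \<le> n"
      "e = {grid_node s i j, grid_node s i (j + 1)}"
proof -
  obtain p q where pq: "e = {p, q}" "p \<in> inner_nodes" "adjacent p q"
    using assms by (auto simp: edges_def)
  then have "q \<in> neighbours p"
    by (simp add: mem_neighbours_iff)
  moreover obtain i j where p: "on_grid n i j" "p = grid_node s i j"
    by (rule grid_node_cases)
  moreover have ij: "1 \<le> i" "i \<le> n" "1 \<le> j" "j \<le> n"
    using pq(2) p by (simp_all add: grid_node_inner_iff)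
  ultimately consider "q = grid_node s (i + 1) j" | "q = grid_node s (i - 1) j"
    | "q = grid_node s i (j + 1)" | "q = grid_node s i (j - 1)"
    by (auto simp: neighbours_inner)
  then show ?thesis
  proof cases
    case 1
    with ij p pq show ?thesis
      by (intro that(1)[of i j]) (auto simp: on_grid_def)
  next
    case 2
    with ij p pq show ?thesis
      by (intro that(1)[of "i - 1" j]) (auto simp: on_grid_def)
  next
    case 3
    with ij p pq show ?thesis
      by (intro that(2)[of i j]) (auto simp: on_grid_def)
  next
    case 4
    with ij p pq show ?thesis
      by (intro that(2)[of i "j - 1"]) (auto simp: on_grid_def)
  qed
qed

end

section \<open>Well-posedness of the Dirichlet problem\<close>

text \<open>Without a zero, \<open>v\<close> could be sent to the point of the sphere of radius
  \<open>R\<close> opposite to the direction of \<open>G v\<close>. A Brouwer fixed point of this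
  map lies on the sphere and has \<open>G v \<bullet> v < 0\<close>, against the outward-pointing
  hypothesis.\<close>

lemma brouwer_zero:
  fixes G :: "'a::euclidean_space \<Rightarrow> 'a"
  assumes "continuous_on (cball 0 R) G" "R > 0" "\<And>v. norm v = R \<Longrightarrow> G v \<bullet> v > 0"
  shows "\<exists>v. G v = 0"
proof (rule ccontr)
  assume nz: "\<nexists>v. G v = 0"
  let ?H = "\<lambda>v. - (R / norm (G v)) *\<^sub>R G v"
  have "norm (?H v) = R" for v
    using nz assms(2) by simp
  then have "?H ` cball 0 R \<subseteq> cball 0 R"
    by auto
  moreover have "continuous_on (cball 0 R) ?H"
    using nz assms(1) by (intro continuous_intros) auto
  ultimately obtain v where v: "?H v = v"
    using brouwer_ball[OF assms(2), of 0 ?H] by (metis image_subset_iff_funcset)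
  then have "norm v = R"
    using \<open>\<And>v. norm (?H v) = R\<close> by metis
  moreover have "G v \<bullet> v = - (R / norm (G v)) * (G v \<bullet> G v)"
    using arg_cong[OF v, of "inner (G v)"] by simp
  moreover have "(R / norm (G v)) * (G v \<bullet> G v) > 0"
    using nz assms(2) by simp
  ultimately show False
    using assms(3)[of v] by simp
qed

text \<open>The constant is the minimum of \<open>Q\<close> on the compact unit sphere; homogeneity
  extends the bound to all vectors.\<close>

lemma quadratic_form_coercive:
  fixes Q :: "'a::euclidean_space \<Rightarrow> real"
  assumes "continuous_on UNIV Q" "\<And>t v. Q (t *\<^sub>R v) = t\<^sup>2 * Q v" "\<And>v. v \<noteq> 0 \<Longrightarrow> Q v > 0"
  shows "\<exists>c>0. \<forall>v. c * (norm v)\<^sup>2 \<le> Q v"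
proof -
  obtain b :: 'a where "b \<in> Basis"
    using nonempty_Basis by blast
  then have ne: "sphere (0 :: 'a) 1 \<noteq> {}"
    using norm_Basis by auto
  have "continuous_on (sphere 0 1) Q"
    using assms(1) continuous_on_subset by blast
  then obtain m where m: "m \<in> sphere 0 1" "\<And>v. v \<in> sphere 0 1 \<Longrightarrow> Q m \<le> Q v"
    using continuous_attains_inf[OF compact_sphere ne] by blast
  have "Q m * (norm v)\<^sup>2 \<le> Q v" for v
  proof (cases "v = 0")
    case True
    then show ?thesis
      using assms(2)[of 0 0] by simp
  next
    case False
    then have "Q m \<le> Q (inverse (norm v) *\<^sub>R v)"
      by (intro m(2)) simp
    then show ?thesis
      using False by (simp add: assms(2) power_inverse field_simps)
  qed
  moreover have "Q m > 0"
    using m(1) by (intro assms(3)) auto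
  ultimately show ?thesis
    by blast
qed

section \<open>Energy estimates, uniqueness and existence\<close>

lemma cond_commute: "cond \<gamma> p q = cond \<gamma> q p"
  by (simp add: cond_def insert_commute)

lemma cond_pos: "\<gamma> \<in> conductivities \<Longrightarrow> cond \<gamma> p q > 0"
  by (simp add: cond_def conductivities_def)

lemma neighbours_commute: "q \<in> neighbours p \<longleftrightarrow> p \<in> neighbours q"
  by (simp add: neighbours_def insert_commute)

text \<open>Summation by parts (the discrete Green formula). Vanishing outside the interior lets the
  sum run over all nodes; averaging it with its copy under exchange of \<open>p\<close> and
  \<open>q\<close> produces the squares. Each edge is counted from both ends, whence the factor
  1/2.\<close>

lemma energy_identity:
  fixes v :: "real ^ 'n::finite node"
  assumes "\<And>p. p \<notin> inner_nodes \<Longrightarrow> v $ p = 0"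
  shows "(\<Sum>p\<in>inner_nodes. v $ p * (\<Sum>q\<in>neighbours p. cond \<gamma> p q * (v $ q - v $ p))) =
    - (\<Sum>p\<in>UNIV. \<Sum>q\<in>neighbours p. cond \<gamma> p q * (v $ p - v $ q)\<^sup>2) / 2"
proof -
  let ?S = "\<lambda>F. \<Sum>p\<in>UNIV. \<Sum>q\<in>neighbours p. cond \<gamma> p q * F (v $ p) (v $ q)"
  have swap: "?S F = ?S (\<lambda>a b. F b a)" for F
  proof -
    have "?S F = (\<Sum>q\<in>UNIV. \<Sum>p | p \<in> UNIV \<and> q \<in> neighbours p. cond \<gamma> p q * F (v $ p) (v $ q))"
      using sum.swap_restrict[of "UNIV :: 'n node set" "UNIV :: 'n node set"
          "\<lambda>p q. cond \<gamma> p q * F (v $ p) (v $ q)" "\<lambda>p q. q \<in> neighbours p"] by simp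
    also have "\<dots> = ?S (\<lambda>a b. F b a)"
      by (intro sum.cong) (auto simp: neighbours_commute cond_commute)
    finally show ?thesis .
  qed
  have "(\<Sum>p\<in>inner_nodes. v $ p * (\<Sum>q\<in>neighbours p. cond \<gamma> p q * (v $ q - v $ p))) =
      ?S (\<lambda>a b. a * (b - a))"
    using assms by (subst sum.mono_neutral_cong_left[of UNIV]) (auto simp: sum_distrib_left mult_ac)
  moreover have "?S (\<lambda>a b. a * (b - a)) + ?S (\<lambda>a b. b * (a - b)) = - ?S (\<lambda>a b. (a - b)\<^sup>2)"
    unfolding sum.distrib[symmetric] sum_negf[symmetric]
    by (intro sum.cong) (auto simp: algebra_simps power2_eq_square)
  ultimately show ?thesis
    using swap[of "\<lambda>a b. a * (b - a)"] by simp
qed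

lemma energy_nonneg_imp_zero:
  fixes v :: "real ^ 'n::finite node"
  assumes "\<gamma> \<in> conductivities" "\<And>p. p \<notin> inner_nodes \<Longrightarrow> v $ p = 0"
    and "(\<Sum>p\<in>inner_nodes. v $ p * (\<Sum>q\<in>neighbours p. cond \<gamma> p q * (v $ q - v $ p))) \<ge> 0"
  shows "v = 0"
proof -
  define n where "n = int CARD('n)"
  have nonneg: "cond \<gamma> p q * (v $ p - v $ q)\<^sup>2 \<ge> 0" for p q
    using cond_pos[OF assms(1), of p q] by simp
  have "(\<Sum>p\<in>UNIV. \<Sum>q\<in>neighbours p. cond \<gamma> p q * (v $ p - v $ q)\<^sup>2) \<le> 0"
    using assms(3) energy_identity[OF assms(2)] by simp
  then have "(\<Sum>p\<in>UNIV. \<Sum>q\<in>neighbours p. cond \<gamma> p q * (v $ p - v $ q)\<^sup>2) = 0"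
    by (intro antisym sum_nonneg nonneg)
  then have "\<forall>p. (\<Sum>q\<in>neighbours p. cond \<gamma> p q * (v $ p - v $ q)\<^sup>2) = 0"
    by (subst (asm) sum_nonneg_eq_0_iff) (auto intro!: sum_nonneg nonneg)
  then have "cond \<gamma> p q * (v $ p - v $ q)\<^sup>2 = 0" if "q \<in> neighbours p" for p q
    using that by (subst (asm) sum_nonneg_eq_0_iff) (auto simp: nonneg)
  then have eq: "v $ p = v $ q" if "q \<in> neighbours p" for p q
    using that cond_pos[OF assms(1), of p q] by force
  \<comment> \<open>The energy vanishes, so \<open>v\<close> is equal at the two ends of every edge;
    the boundary value 0 at the left end of each row is carried along that row.\<close>
  have row: "v $ grid_node True (int i) j = 0" if "1 \<le> j" "j \<le> n" "int i \<le> n" for i :: nat and j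
    using that(3)
  proof (induction i)
    case 0
    have "on_grid n 0 j"
      using that by (simp add: on_grid_def)
    then show ?case
      using assms(2) by (simp add: grid_node_inner_iff n_def)
  next
    case (Suc i)
    have "(grid_node True (int i) j :: 'n node) \<in> neighbours (grid_node True (int (Suc i)) j)"
      using neighbours_inner[OF n_def, of "int (Suc i)" j True] Suc.prems that by simp
    then show ?case
      using eq Suc by fastforce
  qed
  have "v $ p = 0" for p
  proof (cases "p \<in> inner_nodes")
    case True
    obtain i j where ij: "on_grid n i j" "p = grid_node True i j"
      by (rule grid_node_cases[OF n_def])
    then show ?thesis
      using True row[of j "nat i"] by (simp add: grid_node_inner_iff[OF n_def])
  qed (rule assms(2))
  then show ?thesis
    by (simp add: vec_eq_iff)
qed

lemma boundary_value:
  fixes u :: "real ^ 'n::finite node"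
  assumes "\<forall>b. u $ Rep_bnode b = \<phi> $ b" "p \<notin> inner_nodes"
  shows "u $ p = \<phi> $ Abs_bnode p"
proof -
  have "p \<in> boundary_nodes"
    using assms(2) by (simp add: boundary_nodes_eq)
  then show ?thesis
    using assms(1) by (metis Abs_bnode_inverse)
qed

text \<open>The difference of two solutions is tested against itself: monotonicity makes each inner
  term nonnegative, while the energy identity makes their sum nonpositive.\<close>

lemma semilinear_solution_unique:
  fixes u u' :: "real ^ 'n::finite node"
  assumes "\<gamma> \<in> conductivities" "\<And>p. p \<in> inner_nodes \<Longrightarrow> mono (g p)"
    and u: "semilinear_solution g \<gamma> \<phi> u" and u': "semilinear_solution g \<gamma> \<phi> u'"
  shows "u = u'"
proof -
  let ?v = "u - u'"
  have "?v $ p = 0" if "p \<notin> inner_nodes" for p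
    using that u u' boundary_value[of _ \<phi> p] by (simp add: semilinear_solution_def)
  moreover have "?v $ p * (\<Sum>q\<in>neighbours p. cond \<gamma> p q * (?v $ q - ?v $ p)) \<ge> 0"
    if p: "p \<in> inner_nodes" for p
  proof -
    have "(\<Sum>q\<in>neighbours p. cond \<gamma> p q * (?v $ q - ?v $ p)) =
        (\<Sum>q\<in>neighbours p. cond \<gamma> p q * (u $ q - u $ p)) -
        (\<Sum>q\<in>neighbours p. cond \<gamma> p q * (u' $ q - u' $ p))"
      by (simp add: algebra_simps flip: sum_subtractf)
    also have "\<dots> = g p (u $ p) - g p (u' $ p)"
      using p u u' by (simp add: semilinear_solution_def)
    finally have "(\<Sum>q\<in>neighbours p. cond \<gamma> p q * (?v $ q - ?v $ p)) = g p (u $ p) - g p (u' $ p)" .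
    moreover have "(a - b) * (g p a - g p b) \<ge> 0" for a b
      using monoD[OF assms(2)[OF p], of a b] monoD[OF assms(2)[OF p], of b a]
      by (cases "a \<le> b") (auto intro: mult_nonneg_nonneg mult_nonpos_nonpos)
    ultimately show ?thesis
      by simp
  qed
  then have "(\<Sum>p\<in>inner_nodes. ?v $ p * (\<Sum>q\<in>neighbours p. cond \<gamma> p q * (?v $ q - ?v $ p))) \<ge> 0"
    by (rule sum_nonneg)
  ultimately have "?v = 0"
    by (rule energy_nonneg_imp_zero[OF assms(1)])
  then show ?thesis
    by simp
qed

lemma semilinear_solution_exists:
  fixes g :: "'n::finite node \<Rightarrow> real \<Rightarrow> real"
  assumes "\<gamma> \<in> conductivities" "\<And>p. p \<in> inner_nodes \<Longrightarrow> mono (g p)"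
    and "\<And>p. p \<in> inner_nodes \<Longrightarrow> continuous_on UNIV (g p)"
  shows "\<exists>u. semilinear_solution g \<gamma> \<phi> u"
proof -
  let ?I = "inner_nodes :: 'n node set"
  define z :: "real ^ 'n node \<Rightarrow> real ^ 'n node"
    \<comment> \<open>The solution is sought as \<open>z v + a\<close>, with \<open>a\<close>
      carrying the boundary datum. The boundary components of \<open>v\<close> are dummies, and
      \<open>G\<close> asks them to be 0, so that unknowns and equations live in the same Euclidean
      space. \<open>Q\<close> is the energy of \<open>z v\<close> plus the squares of the dummies,
      and \<open>b\<close> is \<open>G 0\<close>.\<close>
    where "z v = (\<chi> p. if p \<in> inner_nodes then v $ p else 0)" for v
  define a :: "real ^ 'n node" where "a = (\<chi> p. if p \<in> inner_nodes then 0 else \<phi> $ Abs_bnode p)"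
  define L :: "real ^ 'n node \<Rightarrow> 'n node \<Rightarrow> real"
    where "L w p = (\<Sum>q\<in>neighbours p. cond \<gamma> p q * (w $ q - w $ p))" for w p
  define Q where "Q v = (\<Sum>p\<in>-?I. (v $ p)\<^sup>2) - (\<Sum>p\<in>?I. v $ p * L (z v) p)" for v
  define G :: "real ^ 'n node \<Rightarrow> real ^ 'n node"
    where "G v = (\<chi> p. if p \<in> inner_nodes then g p (v $ p) - L (z v + a) p else v $ p)" for v
  define b :: "real ^ 'n node" where "b = (\<chi> p. if p \<in> inner_nodes then g p 0 - L a p else 0)"
  have L_add: "L (v + w) p = L v p + L w p" for v w p
    by (simp add: L_def algebra_simps sum.distrib sum_subtractf)
  have "continuous_on UNIV (\<lambda>v. z v $ p)" for p
    by (cases "p \<in> ?I") (simp_all add: z_def continuous_intros)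
  then have cont_L: "continuous_on UNIV (\<lambda>v. L (z v) p)" for p
    unfolding L_def
    by (intro continuous_on_sum continuous_on_mult continuous_on_const continuous_on_diff)
  have "\<exists>c>0. \<forall>v. c * (norm v)\<^sup>2 \<le> Q v"
  proof (rule quadratic_form_coercive)
    show "continuous_on UNIV Q"
      unfolding Q_def by (intro continuous_intros cont_L)
    have "L (z (t *\<^sub>R v)) p = t * L (z v) p" for t v p
      by (auto simp: L_def z_def sum_distrib_left algebra_simps intro!: sum.cong)
    then show "Q (t *\<^sub>R v) = t\<^sup>2 * Q v" for t v
      by (simp add: Q_def power_mult_distrib sum_distrib_left right_diff_distrib power2_eq_square mult_ac)
    show "Q v > 0" if "v \<noteq> 0" for v
    proof (rule ccontr)
      assume "\<not> Q v > 0"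
      have "(\<Sum>p\<in>?I. v $ p * L (z v) p) =
          (\<Sum>p\<in>?I. z v $ p * (\<Sum>q\<in>neighbours p. cond \<gamma> p q * (z v $ q - z v $ p)))"
        by (intro sum.cong) (auto simp: L_def z_def)
      also have "\<dots> = - (\<Sum>p\<in>UNIV. \<Sum>q\<in>neighbours p. cond \<gamma> p q * (z v $ p - z v $ q)\<^sup>2) / 2"
        by (rule energy_identity) (simp add: z_def)
      also have "\<dots> \<le> 0"
        using cond_pos[OF assms(1)] by (auto intro!: sum_nonneg simp: less_imp_le)
      finally have neg: "(\<Sum>p\<in>?I. v $ p * L (z v) p) \<le> 0" .
      have sq: "(\<Sum>p\<in>-?I. (v $ p)\<^sup>2) \<ge> 0"
        by (intro sum_nonneg) simp
      have "(\<Sum>p\<in>-?I. (v $ p)\<^sup>2) = 0" and zero: "(\<Sum>p\<in>?I. v $ p * L (z v) p) = 0"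
        using neg sq \<open>\<not> Q v > 0\<close> unfolding Q_def by linarith+
      then have bd: "v $ p = 0" if "p \<notin> ?I" for p
        using that by (subst (asm) sum_nonneg_eq_0_iff) auto
      then have "z v = v"
        by (auto simp: z_def vec_eq_iff)
      then have "v = 0"
        using zero bd by (intro energy_nonneg_imp_zero[OF assms(1)]) (simp_all add: L_def)
      with that show False
        by simp
    qed
  qed
  then obtain c where c: "c > 0" "\<And>v. c * (norm v)\<^sup>2 \<le> Q v"
    by blast
  \<comment> \<open>The difference of the two sides consists only of the terms
    \<open>(g p t - g p 0) * t\<close>, which are nonnegative by monotonicity.\<close>
  have lower: "Q v + b \<bullet> v \<le> G v \<bullet> v" for v
  proof -
    have "0 \<le> (g p t - g p 0) * t" if "p \<in> ?I" for p t
      using monoD[OF assms(2)[OF that], of t 0] monoD[OF assms(2)[OF that], of 0 t]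
      by (cases "t \<le> 0") (auto intro: mult_nonneg_nonneg mult_nonpos_nonpos)
    then have "0 \<le> (\<Sum>p\<in>?I. (g p (v $ p) - g p 0) * v $ p)"
      by (intro sum_nonneg) simp
    moreover have split: "w \<bullet> v = (\<Sum>p\<in>?I. w $ p * v $ p) + (\<Sum>p\<in>-?I. w $ p * v $ p)" for w
      using sum.Int_Diff[of UNIV "\<lambda>p. w $ p * v $ p" ?I] by (simp add: inner_vec_def Compl_eq_Diff_UNIV)
    have "G v \<bullet> v - (Q v + b \<bullet> v) = (\<Sum>p\<in>?I. (g p (v $ p) - g p 0) * v $ p)"
      unfolding split[of "G v"] split[of b]
      by (simp add: Q_def G_def b_def L_add algebra_simps sum.distrib sum_subtractf power2_eq_square)
    ultimately show ?thesis
      by linarith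
  qed
  \<comment> \<open>Any radius with \<open>c * R > norm b\<close> works: the quadratic part then
    beats the linear term \<open>b \<bullet> v\<close> on the sphere.\<close>
  define R where "R = norm b / c + 1"
  have "\<exists>v. G v = 0"
  proof (rule brouwer_zero)
    have "continuous_on UNIV (\<lambda>v. g p (v $ p) - L (z v + a) p)" if "p \<in> ?I" for p
      unfolding L_add
      by (intro continuous_intros cont_L continuous_on_compose2[OF assms(3)[OF that]]) auto
    then have "continuous_on UNIV (\<lambda>v. G v $ p)" for p
      by (cases "p \<in> ?I") (auto simp: G_def intro: continuous_intros)
    then have "continuous_on UNIV (\<lambda>v. \<chi> p. G v $ p)"
      by (rule continuous_on_vec_lambda)
    then show "continuous_on (cball 0 R) G"
      using continuous_on_subset by (auto intro: continuous_on_subset)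
    show "R > 0"
      using c(1) by (simp add: R_def add_nonneg_pos)
    show "G v \<bullet> v > 0" if v: "norm v = R" for v
    proof -
      have "norm b < c * R"
        using c(1) by (simp add: R_def field_simps)
      then have "norm b * R < c * R\<^sup>2"
        using \<open>R > 0\<close> by (simp add: power2_eq_square)
      moreover have "- (b \<bullet> v) \<le> norm b * R"
        using Cauchy_Schwarz_ineq2[of b v] v by simp
      ultimately show ?thesis
        using c(2)[of v] lower[of v] v by simp
    qed
  qed
  then obtain v where v: "G v = 0" ..
  let ?u = "z v + a"
  have u_inner: "?u $ p = v $ p" if "p \<in> ?I" for p
    using that by (simp add: z_def a_def)
  have "L ?u p = g p (?u $ p)" if "p \<in> ?I" for p
    using arg_cong[OF v, of "\<lambda>w. w $ p"] that u_inner[OF that] by (simp add: G_def)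
  moreover have "Rep_bnode b \<notin> ?I" for b :: "'n bnode"
    using Rep_bnode[of b] boundary_nodes_eq by blast
  then have "?u $ Rep_bnode b = \<phi> $ b" for b
    by (simp add: z_def a_def Rep_bnode_inverse)
  ultimately show ?thesis
    unfolding semilinear_solution_def L_def by blast
qed

lemma semilinear_solution_solution:
  assumes "\<gamma> \<in> conductivities" "\<And>p. p \<in> inner_nodes \<Longrightarrow> mono (g p)"
    and "\<And>p. p \<in> inner_nodes \<Longrightarrow> continuous_on UNIV (g p)"
  shows "semilinear_solution g \<gamma> \<phi> (solution g \<gamma> \<phi>)"
  unfolding solution_def
proof (rule theI')
  show "\<exists>!u. semilinear_solution g \<gamma> \<phi> u"
    using semilinear_solution_exists[of \<gamma> g \<phi>] semilinear_solution_unique[of \<gamma> g \<phi>] assms by blast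
qed

section \<open>The sweep from a corner\<close>

text \<open>
  Here and below, \<open>hc i j\<close> and \<open>vc i j\<close> are the conductivities of the edges from \<open>(i, j)\<close> to
  \<open>(i + 1, j)\<close> and to \<open>(i, j + 1)\<close>.
\<close>

definition grid_flux ::
  "(int \<Rightarrow> int \<Rightarrow> real) \<Rightarrow> (int \<Rightarrow> int \<Rightarrow> real) \<Rightarrow> (int \<Rightarrow> int \<Rightarrow> real) \<Rightarrow> int \<Rightarrow> int \<Rightarrow> real" where
  "grid_flux hc vc w i j =
     hc i j * (w (i + 1) j - w i j) + hc (i - 1) j * (w (i - 1) j - w i j) +
     vc i j * (w i (j + 1) - w i j) + vc i (j - 1) * (w i (j - 1) - w i j)"

text \<open>March from the left: the equation at \<open>(i, j)\<close> yields
  \<open>w (i + 1) j\<close> from columns \<open>i - 1\<close> and \<open>i\<close>. If the new node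
  satisfies \<open>i + 1 + j \<le> n + m\<close>, then so do all nodes used, including
  \<open>(i, j + 1)\<close>. The coefficient \<open>lam\<close> only multiplies a zero value, so it
  may be arbitrary. The case \<open>m = n + 1\<close> covers the whole grid.\<close>

lemma zero_region:
  assumes hc: "\<And>i j. hc i j \<noteq> 0" and "m \<le> n + 1"
    and eq: "\<And>i j. 1 \<le> i \<Longrightarrow> i \<le> n \<Longrightarrow> 1 \<le> j \<Longrightarrow> j \<le> n \<Longrightarrow>
      grid_flux hc vc w i j = lam i j * w i j"
    and left: "\<And>j. 1 \<le> j \<Longrightarrow> j \<le> n \<Longrightarrow> w 0 j = 0" "\<And>j. 1 \<le> j \<Longrightarrow> j \<le> n \<Longrightarrow> w 1 j = 0"
    and bottom: "\<And>i. 1 \<le> i \<Longrightarrow> i \<le> n \<Longrightarrow> w i 0 = 0"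
    and top: "\<And>i. 1 \<le> i \<Longrightarrow> i < m \<Longrightarrow> w i (n + 1) = 0"
    and "on_grid n i j" "i + j \<le> n + m"
  shows "w i j = 0"
proof -
  have "\<forall>j. on_grid n (int a) j \<longrightarrow> int a + j \<le> n + m \<longrightarrow> w (int a) j = 0" for a
  proof (induction a rule: less_induct)
    case (less a)
    show ?case
    proof (intro allI impI)
      fix j
      assume j: "on_grid n (int a) j" "int a + j \<le> n + m"
      consider "a = 0" | "j = 0" | "j = n + 1" | "a = 1" "1 \<le> j" "j \<le> n"
        | "a \<ge> 2" "1 \<le> j" "j \<le> n"
        using j(1) unfolding on_grid_def by linarith
      then show "w (int a) j = 0"
      proof cases
        case 5
        define i where "i = int a - 1"
        have i: "1 \<le> i" "i \<le> n"
          using 5 j(1) by (auto simp: i_def on_grid_def)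
        have prev: "w i' j' = 0" if "on_grid n i' j'" "i' + j' \<le> n + m" "0 \<le> i'" "i' \<le> i" for i' j'
          using less.IH[of "nat i'"] that by (simp add: i_def)
        have "w i j = 0" "w (i - 1) j = 0" "w i (j + 1) = 0" "w i (j - 1) = 0"
          by (rule prev; use 5 i j(2) in \<open>auto simp: on_grid_def i_def\<close>)+
        then have "hc i j * w (i + 1) j = 0"
          using eq[OF i 5(2,3)] by (simp add: grid_flux_def)
        then show ?thesis
          using hc by (simp add: i_def)
      qed (use j assms(2) left bottom top in \<open>auto simp: on_grid_def\<close>)
    qed
  qed
  from this[of "nat i"] show ?thesis
    using assms(8,9) by (auto simp: on_grid_def)
qed

text \<open>
  Reconstruction of everything on and above the diagonal \<open>i + j = n + 1\<close>, proceeding from the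
  corner \<open>(n + 1, n + 1)\<close>. The fields \<open>w m\<close>, whose boundary data are read off the
  Dirichlet-to-Neumann map, vanish below the diagonal \<open>i + j = n + m + 1\<close> and nowhere on it.
  The right-hand sides \<open>c\<close> and \<open>lam\<close> stand for \<open>f\<^sub>p(u\<^sub>p)\<close> and \<open>f\<^sub>p'(u\<^sub>p)\<close>.
\<close>

locale corner_sweep =
  fixes k :: nat and T :: "'x \<Rightarrow> 'a::euclidean_space" and P :: "'x set" and n :: int
    and hc vc u c lam :: "int \<Rightarrow> int \<Rightarrow> 'x \<Rightarrow> real" and w :: "int \<Rightarrow> int \<Rightarrow> int \<Rightarrow> 'x \<Rightarrow> real"
  assumes n_pos: "n \<ge> 1"
    and hc_pos: "x \<in> P \<Longrightarrow> hc i j x > 0" and vc_pos: "x \<in> P \<Longrightarrow> vc i j x > 0"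
    and u_eq: "x \<in> P \<Longrightarrow> 1 \<le> i \<Longrightarrow> i \<le> n \<Longrightarrow> 1 \<le> j \<Longrightarrow> j \<le> n \<Longrightarrow>
      grid_flux (\<lambda>i j. hc i j x) (\<lambda>i j. vc i j x) (\<lambda>i j. u i j x) i j = c i j x"
    and w_eq: "x \<in> P \<Longrightarrow> 1 \<le> m \<Longrightarrow> m \<le> n \<Longrightarrow> 1 \<le> i \<Longrightarrow> i \<le> n \<Longrightarrow> 1 \<le> j \<Longrightarrow> j \<le> n \<Longrightarrow>
      grid_flux (\<lambda>i j. hc i j x) (\<lambda>i j. vc i j x) (\<lambda>i j. w m i j x) i j = lam i j x * w m i j x"
    and w_zero: "x \<in> P \<Longrightarrow> 1 \<le> m \<Longrightarrow> m \<le> n \<Longrightarrow> on_grid n i j \<Longrightarrow> i + j \<le> n + m \<Longrightarrow> w m i j x = 0"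
    and w_top: "x \<in> P \<Longrightarrow> 1 \<le> m \<Longrightarrow> m \<le> n \<Longrightarrow> w m m (n + 1) x = 1"
    and w_boundary: "1 \<le> m \<Longrightarrow> m \<le> n \<Longrightarrow> on_grid n i j \<Longrightarrow> i = n + 1 \<or> j = n + 1 \<Longrightarrow>
      Ck_factors k T P (w m i j)"
    and u_boundary: "on_grid n i j \<Longrightarrow> i = n + 1 \<or> j = n + 1 \<Longrightarrow> Ck_factors k T P (u i j)"
    and vc_top: "1 \<le> i \<Longrightarrow> i \<le> n \<Longrightarrow> Ck_factors k T P (vc i n)"
    and w_layer: "1 \<le> m \<Longrightarrow> m \<le> n \<Longrightarrow> 1 \<le> i \<Longrightarrow> i \<le> n \<Longrightarrow> Ck_factors k T P (w m i n)"
    and u_layer: "1 \<le> i \<Longrightarrow> i \<le> n \<Longrightarrow> Ck_factors k T P (u i n)"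
    and c_factors: "1 \<le> i \<Longrightarrow> i \<le> n \<Longrightarrow> 1 \<le> j \<Longrightarrow> j \<le> n \<Longrightarrow>
      Ck_factors k T P (u i j) \<Longrightarrow> Ck_factors k T P (c i j)"
    and lam_factors: "1 \<le> i \<Longrightarrow> i \<le> n \<Longrightarrow> 1 \<le> j \<Longrightarrow> j \<le> n \<Longrightarrow>
      Ck_factors k T P (u i j) \<Longrightarrow> Ck_factors k T P (lam i j)"
begin

abbreviation fac :: "('x \<Rightarrow> real) \<Rightarrow> bool" where
  "fac \<equiv> Ck_factors k T P"

lemmas fac_intros = Ck_factors_add Ck_factors_diff Ck_factors_mult Ck_factors_minus
  Ck_factors_divide Ck_factors_const

text \<open>The elementary downward step, used both for the fields \<open>w\<close> and for
  \<open>u\<close>: the flux equation is solved for the lowest of its five values, with division by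
  a positive conductivity.\<close>

lemma fac_below:
  assumes "\<And>x. x \<in> P \<Longrightarrow>
      grid_flux (\<lambda>i j. hc i j x) (\<lambda>i j. vc i j x) (\<lambda>i j. y i j x) i j = \<rho> x"
    and "fac (hc i j)" "fac (hc (i - 1) j)" "fac (vc i j)" "fac (vc i (j - 1))"
    and "fac (y i j)" "fac (y (i + 1) j)" "fac (y (i - 1) j)" "fac (y i (j + 1))" "fac \<rho>"
  shows "fac (y i (j - 1))"
proof -
  let ?rest = "\<lambda>x. \<rho> x - hc i j x * (y (i + 1) j x - y i j x) -
    hc (i - 1) j x * (y (i - 1) j x - y i j x) - vc i j x * (y i (j + 1) x - y i j x)"
  have "y i (j - 1) x = y i j x + ?rest x / vc i (j - 1) x" if "x \<in> P" for x
  proof -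
    have "?rest x = vc i (j - 1) x * (y i (j - 1) x - y i j x)"
      using assms(1)[OF that] by (simp add: grid_flux_def)
    then show ?thesis
      using vc_pos[OF that, of i "j - 1"] by simp
  qed
  moreover have "fac (\<lambda>x. y i j x + ?rest x / vc i (j - 1) x)"
    using assms(2-) less_imp_neq[OF vc_pos] by (intro fac_intros) auto
  ultimately show ?thesis
    by (simp cong: Ck_factors_cong)
qed

text \<open>Edges are indexed by their left or lower end, so these are exactly the edges with both
  ends on or above the diagonal \<open>i + j = n + m\<close>.\<close>

definition fac_from :: "int \<Rightarrow> bool" where
  "fac_from m \<longleftrightarrow>
     (\<forall>i j. on_grid n i j \<longrightarrow> i + j \<ge> n + m \<longrightarrow> fac (u i j)) \<and>
     (\<forall>i j. on_grid n i j \<longrightarrow> on_grid n (i + 1) j \<longrightarrow> 1 \<le> j \<longrightarrow> j \<le> n \<longrightarrow> i + j \<ge> n + m \<longrightarrow>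
        fac (hc i j)) \<and>
     (\<forall>i j. on_grid n i j \<longrightarrow> on_grid n i (j + 1) \<longrightarrow> 1 \<le> i \<longrightarrow> i \<le> n \<longrightarrow> i + j \<ge> n + m \<longrightarrow>
        fac (vc i j))"

text \<open>At a node just below the diagonal the value itself and those to its left and below
  vanish. The equation there balances the top and right neighbours alone, so nonvanishing passes
  from one diagonal node to the next.\<close>

lemma w_diagonal_nonzero:
  assumes "x \<in> P" "1 \<le> m" "m \<le> n" "m + int a \<le> n + 1"
  shows "w m (m + int a) (n + 1 - int a) x \<noteq> 0"
  using assms(4)
proof (induction a)
  case 0
  then show ?case
    using w_top[OF assms(1-3)] by simp
next
  case (Suc a)
  let ?i = "m + int a" and ?j = "n - int a"
  have "w m ?i ?j x = 0" "w m (?i - 1) ?j x = 0" "w m ?i (?j - 1) x = 0"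
    by (rule w_zero[OF assms(1-3)]; use Suc.prems assms in \<open>auto simp: on_grid_def\<close>)+
  then have "hc ?i ?j x * w m (?i + 1) ?j x + vc ?i ?j x * w m ?i (?j + 1) x = 0"
    using w_eq[OF assms(1-3), of ?i ?j] Suc.prems assms by (simp add: grid_flux_def)
  moreover have "w m ?i (?j + 1) x \<noteq> 0"
    using Suc by (simp add: algebra_simps)
  ultimately have "w m (?i + 1) ?j x \<noteq> 0"
    using vc_pos[OF assms(1), of ?i ?j] by auto
  then show ?case
    by (simp add: algebra_simps)
qed

text \<open>The order is forced: first the field \<open>w m\<close> on its support, where all
  coefficients are known; then the conductivities of the diagonal \<open>i + j = n + m\<close>, read
  off that field; and only then \<open>u\<close>, whose equation needs these conductivities.\<close>

lemma fac_from_step: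
  assumes m: "1 \<le> m" "m \<le> n" and "fac_from (m + 1)"
  shows "fac_from m"
proof -
  have u_known: "fac (u i j)" if "on_grid n i j" "i + j \<ge> n + m + 1" for i j
    using assms(3) that by (simp add: fac_from_def)
  have hc_known: "fac (hc i j)"
    if "0 \<le> i" "i \<le> n" "1 \<le> j" "j \<le> n" "i + j \<ge> n + m + 1" for i j
    using assms(3) that by (simp add: fac_from_def on_grid_def)
  have vc_known: "fac (vc i j)"
    if "1 \<le> i" "i \<le> n" "0 \<le> j" "j \<le> n" "i + j \<ge> n + m + 1" for i j
    using assms(3) that by (simp add: fac_from_def on_grid_def)
  have lam_known: "fac (lam i j)" if "1 \<le> i" "i \<le> n" "1 \<le> j" "j \<le> n" "i + j \<ge> n + m + 1" for i j
    using that by (intro lam_factors u_known) (auto simp: on_grid_def)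

  \<comment> \<open>Rows are counted downwards by \<open>d\<close>. The top two rows and the right
    column are data; every further value follows from the equation one row higher, which stays
    inside the region already known.\<close>
  have w_rows: "\<forall>i. on_grid n i (n + 1 - int d) \<longrightarrow> i - int d \<ge> m \<longrightarrow> fac (w m i (n + 1 - int d))" for d
  proof (induction d rule: less_induct)
    case (less d)
    show ?case
    proof (intro allI impI)
      fix i
      assume i: "on_grid n i (n + 1 - int d)" "i - int d \<ge> m"
      have prev: "fac (w m i' j')" if "on_grid n i' j'" "i' + j' \<ge> n + m + 1" "j' > n + 1 - int d" for i' j'
      proof -
        have "j' \<le> n + 1"
          using that(1) by (auto simp: on_grid_def)
        then show ?thesis
          using less.IH[of "nat (n + 1 - j')"] that by simp
      qed
      consider "i = n + 1 \<or> d = 0" | "d = 1" "1 \<le> i" "i \<le> n" | "d \<ge> 2" "1 \<le> i" "i \<le> n"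
        using i m unfolding on_grid_def by linarith
      then show "fac (w m i (n + 1 - int d))"
      proof cases
        case 1
        then show ?thesis
          using w_boundary[OF m i(1)] by auto
      next
        case 2
        then show ?thesis
          using w_layer[OF m, of i] by simp
      next
        case 3
        define j where "j = n + 2 - int d"
        have j: "1 \<le> j" "j < n + 1" "i \<ge> 2"
          using 3 i m by (auto simp: on_grid_def j_def)
        have "fac (w m i (j - 1))"
        proof (rule fac_below[where \<rho> = "\<lambda>x. lam i j x * w m i j x"])
          show "fac (w m i j)" "fac (w m (i + 1) j)" "fac (w m (i - 1) j)" "fac (w m i (j + 1))"
            by (rule prev; use 3 i j m in \<open>auto simp: on_grid_def j_def\<close>)+
          then show "fac (\<lambda>x. lam i j x * w m i j x)"
            using i 3 j by (intro fac_intros lam_known) (auto simp: j_def)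
        qed (use w_eq[OF _ m] hc_known vc_known 3 i j in \<open>auto simp: j_def\<close>)
        then show ?thesis
          by (simp add: j_def algebra_simps)
      qed
    qed
  qed
  have w_known: "fac (w m i j)" if "on_grid n i j" "i + j \<ge> n + m + 1" for i j
  proof -
    define d where "d = nat (n + 1 - j)"
    have "n + 1 - int d = j"
      using that(1) by (auto simp: on_grid_def d_def)
    then show ?thesis
      using w_rows[of d] that by simp
  qed

  have flux_on_diagonal: "hc i j x * w m (i + 1) j x + vc i j x * w m i (j + 1) x = 0"
    if "x \<in> P" "1 \<le> i" "i \<le> n" "1 \<le> j" "j \<le> n" "i + j = n + m" for x i j
  proof -
    have "w m i j x = 0" "w m (i - 1) j x = 0" "w m i (j - 1) x = 0"
      by (rule w_zero[OF that(1) m]; use that in \<open>auto simp: on_grid_def\<close>)+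
    then show ?thesis
      using w_eq[OF that(1) m that(2-5)] by (simp add: grid_flux_def)
  qed
  have w_nonzero: "w m i j x \<noteq> 0"
    if "x \<in> P" "j \<le> n + 1" "i \<le> n + 1" "i + j = n + m + 1" for x i j
  proof -
    define d where "d = nat (n + 1 - j)"
    have "m + int d = i" "n + 1 - int d = j"
      using that by (auto simp: d_def)
    then show ?thesis
      using w_diagonal_nonzero[OF that(1) m, of d] that(3) by simp
  qed
  \<comment> \<open>A node of the diagonal \<open>i + j = n + m\<close> determines the ratio of its
    right and upper edges, because \<open>w m\<close> is known and nonzero at their far
    ends.\<close>
  have hc_from_vc: "fac (hc i j)"
    if ij: "1 \<le> i" "i \<le> n" "1 \<le> j" "j \<le> n" "i + j = n + m" and "fac (vc i j)" for i j
  proof -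
    have "hc i j x = - (vc i j x * w m i (j + 1) x) / w m (i + 1) j x" if "x \<in> P" for x
    proof -
      have "hc i j x * w m (i + 1) j x = - (vc i j x * w m i (j + 1) x)"
        using flux_on_diagonal[OF that ij] by linarith
      moreover have "w m (i + 1) j x \<noteq> 0"
        using ij by (intro w_nonzero that) auto
      ultimately show ?thesis
        by (metis nonzero_eq_divide_eq)
    qed
    moreover have "fac (\<lambda>x. - (vc i j x * w m i (j + 1) x) / w m (i + 1) j x)"
      using ij m that(6) by (intro fac_intros w_known w_nonzero) (auto simp: on_grid_def)
    ultimately show ?thesis
      by (simp cong: Ck_factors_cong)
  qed
  \<comment> \<open>At \<open>(i + 1, j)\<close>, where \<open>w m\<close> is nonzero, the left and
    lower neighbours both carry the value 0. Their conductivities enter only through their sum, so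
    the left one gives the lower one.\<close>
  have vc_next: "fac (vc (i + 1) (j - 1))"
    if ij: "1 \<le> i" "i + 1 \<le> n" "1 \<le> j" "j \<le> n" "i + j = n + m" and "fac (hc i j)" for i j
  proof -
    let ?rhs = "\<lambda>x. (hc (i + 1) j x * (w m (i + 2) j x - w m (i + 1) j x) +
      vc (i + 1) j x * (w m (i + 1) (j + 1) x - w m (i + 1) j x) -
      lam (i + 1) j x * w m (i + 1) j x) / w m (i + 1) j x - hc i j x"
    have "vc (i + 1) (j - 1) x = ?rhs x" if "x \<in> P" for x
    proof -
      have zero: "w m i j x = 0" "w m (i + 1) (j - 1) x = 0"
        by (rule w_zero[OF that m]; use ij in \<open>auto simp: on_grid_def\<close>)+
      have "w m (i + 1) j x \<noteq> 0"
        using ij by (intro w_nonzero that) auto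
      moreover have "(vc (i + 1) (j - 1) x + hc i j x) * w m (i + 1) j x =
          hc (i + 1) j x * (w m (i + 2) j x - w m (i + 1) j x) +
          vc (i + 1) j x * (w m (i + 1) (j + 1) x - w m (i + 1) j x) -
          lam (i + 1) j x * w m (i + 1) j x"
        using w_eq[OF that m, of "i + 1" j] ij zero by (simp add: grid_flux_def algebra_simps)
      ultimately show ?thesis
        by (simp add: eq_diff_eq nonzero_eq_divide_eq)
    qed
    moreover have "fac ?rhs"
    proof (rule Ck_factors_diff[OF _ that(6)], intro fac_intros w_known w_nonzero hc_known vc_known
        lam_known)
    qed (use ij m in \<open>auto simp: on_grid_def\<close>)
    ultimately show ?thesis
      by (simp cong: Ck_factors_cong)
  qed
  \<comment> \<open>The staircase starts at the boundary edge above \<open>(m, n)\<close> and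
    alternates the two preceding steps.\<close>
  have stair: "fac (vc (m + int a) (n - int a))" if "m + int a \<le> n" for a
    using that
  proof (induction a)
    case 0
    then show ?case
      using vc_top m by simp
  next
    case (Suc a)
    then have "fac (hc (m + int a) (n - int a))"
      using m by (intro hc_from_vc) auto
    then have "fac (vc (m + int a + 1) (n - int a - 1))"
      using Suc.prems m by (intro vc_next) auto
    then show ?case
      by (simp add: algebra_simps)
  qed
  have vc_diag: "fac (vc i j)" if "1 \<le> i" "i \<le> n" "0 \<le> j" "j \<le> n" "i + j = n + m" for i j
  proof -
    define a where "a = nat (n - j)"
    have eq: "m + int a = i" "n - int a = j"
      using that by (auto simp: a_def)
    show ?thesis
      using stair[of a, unfolded eq] that(2) by simp
  qed
  have hc_diag: "fac (hc i j)" if "1 \<le> i" "i \<le> n" "1 \<le> j" "j \<le> n" "i + j = n + m" for i j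
    using that by (intro hc_from_vc vc_diag) auto
  have hc_new: "fac (hc i j)"
    if "0 \<le> i" "i \<le> n" "1 \<le> j" "j \<le> n" "i + j \<ge> n + m" for i j
    using hc_diag[of i j] hc_known[of i j] that m by (cases "i + j = n + m") auto
  have vc_new: "fac (vc i j)"
    if "1 \<le> i" "i \<le> n" "0 \<le> j" "j \<le> n" "i + j \<ge> n + m" for i j
    using vc_diag[of i j] vc_known[of i j] that by (cases "i + j = n + m") auto

  \<comment> \<open>The equation at \<open>(i, j)\<close> with \<open>i + j = n + m + 1\<close>
    passes from \<open>u (i - 1) j\<close> to \<open>u i (j - 1)\<close>. Its right-hand side is
    available because \<open>u i j\<close> is already known.\<close>
  have u_stair: "fac (u (m + int a) (n - int a))" if "m + int a \<le> n" for a
    using that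
  proof (induction a)
    case 0
    then show ?case
      using u_layer m by simp
  next
    case (Suc a)
    define i j where "i = m + int a + 1" and "j = n - int a"
    have ij: "1 \<le> i - 1" "i \<le> n" "1 \<le> j" "j \<le> n" "i + j = n + m + 1"
      using Suc.prems m by (auto simp: i_def j_def)
    have "fac (u i (j - 1))"
    proof (rule fac_below[where \<rho> = "c i j"])
      show "fac (u (i - 1) j)"
        using Suc by (simp add: i_def j_def)
      show "fac (u i j)" "fac (u (i + 1) j)" "fac (u i (j + 1))"
        using ij by (auto intro!: u_known simp: on_grid_def)
      then show "fac (c i j)"
        using ij by (intro c_factors) auto
    qed (use ij u_eq in \<open>auto intro!: hc_new vc_new\<close>)
    then show ?case
      by (simp add: i_def j_def algebra_simps)
  qed
  have u_new: "fac (u i j)" if ij: "on_grid n i j" "i + j \<ge> n + m" for i j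
  proof -
    consider "i + j \<ge> n + m + 1" | "i = n + 1 \<or> j = n + 1" | "i + j = n + m" "i \<le> n" "j \<le> n"
      using ij unfolding on_grid_def by linarith
    then show ?thesis
    proof cases
      case 3
      define a where "a = nat (n - j)"
      have eq: "m + int a = i" "n - int a = j"
        using 3 by (auto simp: a_def)
      show ?thesis
        using u_stair[of a, unfolded eq] 3(2) by simp
    qed (use ij u_known u_boundary in auto)
  qed
  show ?thesis
    unfolding fac_from_def using u_new hc_new vc_new by (auto simp: on_grid_def)
qed

lemma fac_from_one: "fac_from 1"
proof -
  have "fac_from (n + 1 - int a)" if "int a \<le> n" for a
    using that
  proof (induction a)
    \<comment> \<open>For \<open>m = n + 1\<close> the region contains only the two boundary nodes
      next to the corner, and no edge.\<close>
    case 0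
    show ?case
      using u_boundary by (auto simp: fac_from_def on_grid_def)
  next
    case (Suc a)
    then have "fac_from (n - int a + 1)"
      by (simp add: algebra_simps)
    then have "fac_from (n - int a)"
      using Suc.prems by (auto intro: fac_from_step[of "n - int a"])
    then show ?case
      by (simp add: algebra_simps)
  qed
  from this[of "nat n"] show ?thesis
    using n_pos by simp
qed

end

section \<open>Measurements on the lattice\<close>

lemma open_conductivities: "open (conductivities :: (real ^ 'n::finite edge) set)"
proof -
  have "conductivities = (\<Inter>e. {\<gamma> :: real ^ 'n edge. 0 < \<gamma> $ e})"
    by (auto simp: conductivities_def)
  moreover have "open (\<Inter>e. {\<gamma> :: real ^ 'n edge. 0 < \<gamma> $ e})"
    by (intro open_INT finite ballI open_Collect_less continuous_intros)
  ultimately show ?thesis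
    by simp
qed

text \<open>With \<open>k = r - 1\<close>, both \<open>f p\<close> and its derivative are of class
  \<open>Ck_on k\<close>; the one order lost is due to the potential \<open>f'(u)\<close> of the
  linearized problem.\<close>

locale smooth_network =
  fixes f :: "'n::finite node \<Rightarrow> real \<Rightarrow> real" and k :: nat and N :: int
  assumes N_def: "N = int CARD('n)"
    and smooth: "p \<in> inner_nodes \<Longrightarrow> Ck_on (Suc k) (f p) UNIV"
    and deriv_nonneg: "p \<in> inner_nodes \<Longrightarrow> deriv (f p) t \<ge> 0"
begin

lemma smooth_deriv:
  assumes "p \<in> inner_nodes"
  shows "Ck_on k (deriv (f p)) UNIV"
proof -
  have "(\<lambda>t. frechet_derivative (f p) (at t) 1) = deriv (f p)"
    using smooth[OF assms] by (auto intro: deriv_eq_frechet_derivative)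
  then show ?thesis
    using Ck_on_SucD(2)[OF smooth[OF assms], of 1] by simp
qed

lemma mono_f: "p \<in> inner_nodes \<Longrightarrow> mono (f p)"
  using smooth[of p] deriv_nonneg[of p]
  by (intro monoI DERIV_nonneg_imp_nondecreasing[where f = "f p"])
    (auto simp flip: DERIV_deriv_iff_real_differentiable)

lemma continuous_f: "p \<in> inner_nodes \<Longrightarrow> continuous_on UNIV (f p)"
  using smooth Ck_on_imp_continuous_on by blast

definition data_space :: "((real ^ 'n edge) \<times> (real ^ 'n bnode)) set" where
  "data_space = conductivities \<times> UNIV"

definition measurement ::
  "(real ^ 'n edge) \<times> (real ^ 'n bnode) \<Rightarrow>
    (real ^ 'n bnode ^ 'n bnode) \<times> (real ^ 'n bnode) \<times> (real ^ 'n bnode)" where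
  "measurement x =
     (linearized_dtn f (fst x) (snd x), dtn_map f (fst x) (snd x), snd x)"

abbreviation fac :: "((real ^ 'n edge) \<times> (real ^ 'n bnode) \<Rightarrow> real) \<Rightarrow> bool" where
  "fac \<equiv> Ck_factors k measurement data_space"

definition sol :: "(real ^ 'n edge) \<times> (real ^ 'n bnode) \<Rightarrow> real ^ 'n node" where
  "sol x = solution f (fst x) (snd x)"

definition lin :: "(real ^ 'n edge) \<times> (real ^ 'n bnode) \<Rightarrow> real ^ 'n bnode \<Rightarrow> real ^ 'n node" where
  "lin x h = linearized_solution f (fst x) (snd x) h"

lemma semilinear_solution_sol: "x \<in> data_space \<Longrightarrow> semilinear_solution f (fst x) (snd x) (sol x)"
  unfolding sol_def
  by (intro semilinear_solution_solution mono_f continuous_f) (auto simp: data_space_def)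

lemma
  assumes "x \<in> data_space"
  shows semilinear_solution_lin:
      "semilinear_solution (\<lambda>p t. deriv (f p) (sol x $ p) * t) (fst x) h (lin x h)" (is ?thesis1)
    and lin_unique: "semilinear_solution (\<lambda>p t. deriv (f p) (sol x $ p) * t) (fst x) h w \<Longrightarrow>
      lin x h = w"
proof -
  have cond: "fst x \<in> conductivities"
    using assms by (auto simp: data_space_def)
  \<comment> \<open>A nonnegative potential makes the linearized problem an instance of the monotone
    semilinear one, so existence and uniqueness carry over.\<close>
  have mono: "mono (\<lambda>t. deriv (f p) (sol x $ p) * t)" if "p \<in> inner_nodes" for p
    using deriv_nonneg[OF that] by (auto intro!: monoI mult_left_mono)
  show ?thesis1
    unfolding lin_def linearized_solution_def sol_def[symmetric]
    by (intro semilinear_solution_solution cond mono) (auto intro: continuous_intros)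
  then show "lin x h = w" if "semilinear_solution (\<lambda>p t. deriv (f p) (sol x $ p) * t) (fst x) h w"
    using semilinear_solution_unique[OF cond mono _ that] by blast
qed

lemma linear_lin:
  assumes "x \<in> data_space"
  shows "linear (lin x)"
proof (rule linearI)
  show "lin x (a + b) = lin x a + lin x b" for a b
  proof (rule lin_unique[OF assms])
    have "cond (fst x) p q * ((lin x a + lin x b) $ q - (lin x a + lin x b) $ p) =
        cond (fst x) p q * (lin x a $ q - lin x a $ p) + cond (fst x) p q * (lin x b $ q - lin x b $ p)"
      for p q
      by (simp add: algebra_simps)
    then show "semilinear_solution (\<lambda>p t. deriv (f p) (sol x $ p) * t) (fst x) (a + b) (lin x a + lin x b)"
      using semilinear_solution_lin[OF assms, of a] semilinear_solution_lin[OF assms, of b]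
      unfolding semilinear_solution_def by (simp add: sum.distrib distrib_left)
  qed
  show "lin x (c *\<^sub>R a) = c *\<^sub>R lin x a" for c a
  proof (rule lin_unique[OF assms])
    have "cond (fst x) p q * ((c *\<^sub>R lin x a) $ q - (c *\<^sub>R lin x a) $ p) =
        c * (cond (fst x) p q * (lin x a $ q - lin x a $ p))"
      for p q
      by (simp add: algebra_simps)
    then have "(\<Sum>q\<in>neighbours p. cond (fst x) p q * ((c *\<^sub>R lin x a) $ q - (c *\<^sub>R lin x a) $ p)) =
        c * (\<Sum>q\<in>neighbours p. cond (fst x) p q * (lin x a $ q - lin x a $ p))" for p
      by (simp only: sum_distrib_left)
    then show "semilinear_solution (\<lambda>p t. deriv (f p) (sol x $ p) * t) (fst x) (c *\<^sub>R a) (c *\<^sub>R lin x a)"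
      using semilinear_solution_lin[OF assms, of a]
      unfolding semilinear_solution_def by (simp add: mult_ac)
  qed
qed

text \<open>\<open>matrix\<close> records only the images of the basis vectors; linearity of
  \<open>lin\<close>, a consequence of uniqueness, makes it represent the map on all boundary
  data.\<close>

lemma linearized_dtn_mult:
  assumes "x \<in> data_space"
  shows "fst (measurement x) *v h = neumann_data (fst x) (lin x h)"
proof -
  have "linear (neumann_data (fst x))"
    by (rule linearI)
      (auto simp: neumann_data_def vec_eq_iff algebra_simps sum_distrib_left
        simp flip: sum.distrib intro!: sum.cong)
  then have "linear (\<lambda>h. neumann_data (fst x) (lin x h))"
    using linear_compose[OF linear_lin[OF assms]] by (simp add: o_def)
  then show ?thesis
    unfolding measurement_def linearized_dtn_def lin_def fst_conv
    by (simp add: matrix_works linear_matrix_vector_mul_eq)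
qed

lemma fac_dtn_entry: "fac (\<lambda>x. fst (measurement x) $ b $ c)"
  by (rule Ck_factors_linear[OF bounded_linear_compose[OF bounded_linear_vec_nth
          bounded_linear_compose[OF bounded_linear_vec_nth bounded_linear_fst]]])

lemma fac_neumann: "fac (\<lambda>x. neumann_data (fst x) (sol x) $ b)"
proof -
  have "fac (\<lambda>x. fst (snd (measurement x)) $ b)"
    by (rule Ck_factors_linear[OF bounded_linear_compose[OF bounded_linear_vec_nth
            bounded_linear_compose[OF bounded_linear_fst bounded_linear_snd]]])
  then show ?thesis
    by (simp add: measurement_def dtn_map_def sol_def)
qed

lemma fac_dirichlet: "fac (\<lambda>x. snd x $ b)"
proof -
  have "fac (\<lambda>x. snd (snd (measurement x)) $ b)"
    by (rule Ck_factors_linear[OF bounded_linear_compose[OF bounded_linear_vec_nth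
            bounded_linear_compose[OF bounded_linear_snd bounded_linear_snd]]])
  then show ?thesis
    by (simp add: measurement_def)
qed

section \<open>Boundary data, conductivities and equations in a chart\<close>

definition bnd :: "bool \<Rightarrow> int \<Rightarrow> int \<Rightarrow> 'n bnode" where
  "bnd s i j = Abs_bnode (grid_node s i j)"

lemma Rep_bnd:
  assumes "on_grid N i j" "\<not> (1 \<le> i \<and> i \<le> N \<and> 1 \<le> j \<and> j \<le> N)"
  shows "Rep_bnode (bnd s i j) = grid_node s i j"
proof -
  have "(grid_node s i j :: 'n node) \<in> boundary_nodes"
    using assms by (auto simp: boundary_nodes_eq grid_node_inner_iff[OF N_def])
  then show ?thesis
    by (simp add: bnd_def Abs_bnode_inverse)
qed

lemma bnd_cases:
  obtains i j where "on_grid N i j" "\<not> (1 \<le> i \<and> i \<le> N \<and> 1 \<le> j \<and> j \<le> N)" "b = bnd s i j"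
proof -
  obtain i j where ij: "on_grid N i j" "Rep_bnode b = grid_node s i j"
    by (rule grid_node_cases[OF N_def])
  have "Rep_bnode b \<notin> inner_nodes"
    using Rep_bnode[of b] boundary_nodes_eq by blast
  then have "\<not> (1 \<le> i \<and> i \<le> N \<and> 1 \<le> j \<and> j \<le> N)"
    unfolding ij(2) grid_node_inner_iff[OF N_def ij(1)] .
  moreover have "b = bnd s i j"
    by (simp add: bnd_def Rep_bnode_inverse flip: ij(2))
  ultimately show ?thesis
    using ij(1) that by blast
qed

definition hc :: "bool \<Rightarrow> int \<Rightarrow> int \<Rightarrow> (real ^ 'n edge) \<times> (real ^ 'n bnode) \<Rightarrow> real" where
  "hc s i j x = cond (fst x) (grid_node s i j) (grid_node s (i + 1) j)"

definition vc :: "bool \<Rightarrow> int \<Rightarrow> int \<Rightarrow> (real ^ 'n edge) \<times> (real ^ 'n bnode) \<Rightarrow> real" where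
  "vc s i j x = cond (fst x) (grid_node s i j) (grid_node s i (j + 1))"

text \<open>Valid at all integer positions: even where no edge exists, the value is some component
  of the conductivity vector.\<close>

lemma hc_pos: "x \<in> data_space \<Longrightarrow> hc s i j x > 0"
  and vc_pos: "x \<in> data_space \<Longrightarrow> vc s i j x > 0"
  by (auto simp: hc_def vc_def data_space_def intro: cond_pos)

lemma grid_flux_eq:
  fixes v :: "real ^ 'n node"
  assumes "1 \<le> i" "i \<le> N" "1 \<le> j" "j \<le> N"
  shows "grid_flux (\<lambda>i j. hc s i j x) (\<lambda>i j. vc s i j x) (\<lambda>i j. v $ grid_node s i j) i j =
    (\<Sum>q\<in>neighbours (grid_node s i j).
      cond (fst x) (grid_node s i j) q * (v $ q - v $ grid_node s i j))"
  using cond_commute[of "fst x" "grid_node s i j" "grid_node s (i - 1) j"]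
    cond_commute[of "fst x" "grid_node s i j" "grid_node s i (j - 1)"]
  by (simp add: sum_neighbours_inner[OF N_def assms] grid_flux_def hc_def vc_def)

lemma neumann_top:
  assumes "1 \<le> i" "i \<le> N"
  shows "neumann_data (fst x) v $ bnd s i (N + 1) =
    vc s i N x * (v $ grid_node s i (N + 1) - v $ grid_node s i N)"
  using assms by (simp add: neumann_data_def Rep_bnd on_grid_def neighbours_top[OF N_def] vc_def
      cond_commute[of _ "grid_node s i (N + 1)"])

lemma neumann_left:
  assumes "1 \<le> j" "j \<le> N"
  shows "neumann_data (fst x) v $ bnd s 0 j =
    hc s 0 j x * (v $ grid_node s 0 j - v $ grid_node s 1 j)"
  using assms by (simp add: neumann_data_def Rep_bnd on_grid_def neighbours_left[OF N_def] hc_def)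

lemma sol_bnd:
  assumes "x \<in> data_space" "on_grid N i j" "\<not> (1 \<le> i \<and> i \<le> N \<and> 1 \<le> j \<and> j \<le> N)"
  shows "sol x $ grid_node s i j = snd x $ bnd s i j"
  using semilinear_solution_sol[OF assms(1)] Rep_bnd[OF assms(2,3), of s]
  by (metis semilinear_solution_def)

lemma lin_bnd:
  assumes "x \<in> data_space" "on_grid N i j" "\<not> (1 \<le> i \<and> i \<le> N \<and> 1 \<le> j \<and> j \<le> N)"
  shows "lin x h $ grid_node s i j = h $ bnd s i j"
  using semilinear_solution_lin[OF assms(1), of h] Rep_bnd[OF assms(2,3), of s]
  by (metis semilinear_solution_def)

lemma lin_grid:
  assumes "x \<in> data_space" "1 \<le> i" "i \<le> N" "1 \<le> j" "j \<le> N"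
  shows "grid_flux (\<lambda>i j. hc s i j x) (\<lambda>i j. vc s i j x) (\<lambda>i j. lin x h $ grid_node s i j) i j =
    deriv (f (grid_node s i j)) (sol x $ grid_node s i j) * lin x h $ grid_node s i j"
  using semilinear_solution_lin[OF assms(1), of h] assms(2-5)
  by (simp add: grid_flux_eq semilinear_solution_def grid_node_inner_iff[OF N_def] on_grid_def)

lemma sol_grid:
  assumes "x \<in> data_space" "1 \<le> i" "i \<le> N" "1 \<le> j" "j \<le> N"
  shows "grid_flux (\<lambda>i j. hc s i j x) (\<lambda>i j. vc s i j x) (\<lambda>i j. sol x $ grid_node s i j) i j =
    f (grid_node s i j) (sol x $ grid_node s i j)"
  using semilinear_solution_sol[OF assms(1)] assms(2-5)
  by (simp add: grid_flux_eq semilinear_solution_def grid_node_inner_iff[OF N_def] on_grid_def)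

text \<open>
  The system \<open>cauchy_matrix s x *v h = b\<close> prescribes the Dirichlet data \<open>h\<close> on the sides left, bottom
  and top, and the Neumann data on the left side in place of \<open>h\<close> on the right side.
\<close>

definition cauchy_row :: "bool \<Rightarrow> 'n bnode \<Rightarrow> int option" where
  "cauchy_row s b =
     (if \<exists>j. 1 \<le> j \<and> j \<le> N \<and> b = bnd s (N + 1) j
      then Some (THE j. 1 \<le> j \<and> j \<le> N \<and> b = bnd s (N + 1) j) else None)"

definition cauchy_matrix ::
  "bool \<Rightarrow> (real ^ 'n edge) \<times> (real ^ 'n bnode) \<Rightarrow> real ^ 'n bnode ^ 'n bnode" where
  "cauchy_matrix s x =
     (\<chi> b. case cauchy_row s b of None \<Rightarrow> axis b 1 | Some j \<Rightarrow> fst (measurement x) $ bnd s 0 j)"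

lemma bnd_inject:
  assumes "on_grid N i j" "\<not> (1 \<le> i \<and> i \<le> N \<and> 1 \<le> j \<and> j \<le> N)"
    and "on_grid N i' j'" "\<not> (1 \<le> i' \<and> i' \<le> N \<and> 1 \<le> j' \<and> j' \<le> N)"
  shows "bnd s i j = bnd s i' j' \<longleftrightarrow> i = i' \<and> j = j'"
  using Rep_bnd[OF assms(1,2), of s] Rep_bnd[OF assms(3,4), of s]
    grid_node_inject[OF N_def assms(1,3)] by metis

lemma cauchy_row_right:
  assumes "1 \<le> j" "j \<le> N"
  shows "cauchy_row s (bnd s (N + 1) j) = Some j"
proof -
  have "1 \<le> j' \<and> j' \<le> N \<and> bnd s (N + 1) j = bnd s (N + 1) j' \<longleftrightarrow> j' = j" for j'
    using assms by (auto simp: bnd_inject on_grid_def)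
  then show ?thesis
    unfolding cauchy_row_def by simp
qed

lemma cauchy_row_other:
  assumes "on_grid N i j" "\<not> (1 \<le> i \<and> i \<le> N \<and> 1 \<le> j \<and> j \<le> N)" "i \<noteq> N + 1"
  shows "cauchy_row s (bnd s i j) = None"
  using assms by (auto simp: cauchy_row_def bnd_inject on_grid_def)

lemma cauchy_matrix_mult:
  assumes "x \<in> data_space"
  shows "(cauchy_matrix s x *v h) $ b =
    (case cauchy_row s b of None \<Rightarrow> h $ b | Some j \<Rightarrow> neumann_data (fst x) (lin x h) $ bnd s 0 j)"
  unfolding linearized_dtn_mult[OF assms, symmetric]
  by (auto simp: cauchy_matrix_def matrix_vector_mult_def axis_def if_distrib if_distribR
      split: option.split cong: if_cong)

lemma lin_zero:
  assumes x: "x \<in> data_space" and "m \<le> N + 1"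
    and A: "\<And>i j. on_grid N i j \<Longrightarrow> \<not> (1 \<le> i \<and> i \<le> N \<and> 1 \<le> j \<and> j \<le> N) \<Longrightarrow>
      j = N + 1 \<longrightarrow> i < m \<Longrightarrow> (cauchy_matrix s x *v h) $ bnd s i j = 0"
    and "on_grid N i j" "i + j \<le> N + m"
  shows "lin x h $ grid_node s i j = 0"
proof (rule zero_region[where hc = "\<lambda>i j. hc s i j x" and vc = "\<lambda>i j. vc s i j x" and n = N and m = m
      and w = "\<lambda>i j. lin x h $ grid_node s i j"
      and lam = "\<lambda>i j. deriv (f (grid_node s i j)) (sol x $ grid_node s i j)"])
  have other: "lin x h $ grid_node s i j = 0"
    if "on_grid N i j" "\<not> (1 \<le> i \<and> i \<le> N \<and> 1 \<le> j \<and> j \<le> N)" "i \<noteq> N + 1" "j = N + 1 \<longrightarrow> i < m"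
    for i j
    using A[OF that(1,2,4)] that
    by (simp add: cauchy_matrix_mult[OF x] cauchy_row_other lin_bnd[OF x])
  show left: "lin x h $ grid_node s 0 j = 0" if "1 \<le> j" "j \<le> N" for j
    using that by (intro other) (auto simp: on_grid_def)
  show "lin x h $ grid_node s 1 j = 0" if "1 \<le> j" "j \<le> N" for j
  proof -
    \<comment> \<open>The row belonging to the right boundary node at height \<open>j\<close> holds
      the Neumann condition at the left node of the same height; together with zero Dirichlet data
      there it kills the first column.\<close>
    have "neumann_data (fst x) (lin x h) $ bnd s 0 j = 0"
      using A[of "N + 1" j] that
      by (simp add: on_grid_def cauchy_matrix_mult[OF x] cauchy_row_right)
    then show ?thesis
      using left[OF that] hc_pos[OF x, of s 0 j] by (simp add: neumann_left[OF that])
  qed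
  show "lin x h $ grid_node s i 0 = 0" if "1 \<le> i" "i \<le> N" for i
    using that by (intro other) (auto simp: on_grid_def)
  show "lin x h $ grid_node s i (N + 1) = 0" if "1 \<le> i" "i < m" for i
    using that assms(2) by (intro other) (auto simp: on_grid_def)
  show "hc s i j x \<noteq> 0" for i j
    using hc_pos[OF x, of s i j] by simp
qed (use assms lin_grid[OF x] in auto)

text \<open>For \<open>h\<close> in the kernel, \<open>m = N + 1\<close> is allowed in
  \<open>lin_zero\<close>, and the region of vanishing is then the whole grid; \<open>h\<close> is
  the boundary trace of \<open>lin x h\<close>, hence 0.\<close>

lemma det_cauchy_matrix:
  assumes x: "x \<in> data_space"
  shows "det (cauchy_matrix s x) \<noteq> 0"
proof -
  have "h = 0" if h: "cauchy_matrix s x *v h = 0" for h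
  proof -
    have "h $ b = 0" for b
    proof -
      obtain i j where b: "on_grid N i j" "\<not> (1 \<le> i \<and> i \<le> N \<and> 1 \<le> j \<and> j \<le> N)" "b = bnd s i j"
        by (rule bnd_cases)
      have "lin x h $ grid_node s i j = 0"
        by (rule lin_zero[OF x, of "N + 1" s]) (use h b in \<open>auto simp: on_grid_def\<close>)
      then show ?thesis
        using b lin_bnd[OF x b(1,2)] by simp
    qed
    then show ?thesis
      by (simp add: vec_eq_iff)
  qed
  then show ?thesis
    using matrix_left_invertible_ker[of "cauchy_matrix s x"] invertible_det_nz
      invertible_left_inverse by blast
qed

section \<open>Boundary data of the sweeping fields\<close>

definition special :: "bool \<Rightarrow> int \<Rightarrow> (real ^ 'n edge) \<times> (real ^ 'n bnode) \<Rightarrow> real ^ 'n bnode" where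
  "special s m x = (SOME h. cauchy_matrix s x *v h = axis (bnd s m (N + 1)) 1)"

lemma cauchy_matrix_special:
  assumes "x \<in> data_space"
  shows "cauchy_matrix s x *v special s m x = axis (bnd s m (N + 1)) 1"
  unfolding special_def
  by (rule someI[of "\<lambda>h. cauchy_matrix s x *v h = _"])
    (use cramer[OF det_cauchy_matrix[OF assms]] in blast)

lemma fac_special: "fac (\<lambda>x. special s m x $ b)"
proof (rule Ck_factors_linear_system[OF _ _ det_cauchy_matrix cauchy_matrix_special])
  show "fac (\<lambda>x. cauchy_matrix s x $ b $ c)" for b c
    by (cases "cauchy_row s b") (simp_all add: cauchy_matrix_def Ck_factors_const fac_dtn_entry)
qed (rule Ck_factors_const)

lemma lin_special_zero:
  assumes "x \<in> data_space" "1 \<le> m" "m \<le> N" "on_grid N i j" "i + j \<le> N + m"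
  shows "lin x (special s m x) $ grid_node s i j = 0"
proof (rule lin_zero[OF assms(1) _ _ assms(4,5)])
  fix i j
  assume "on_grid N i j" "\<not> (1 \<le> i \<and> i \<le> N \<and> 1 \<le> j \<and> j \<le> N)" "j = N + 1 \<longrightarrow> i < m"
  then have "bnd s i j \<noteq> bnd s m (N + 1)"
    using assms by (subst bnd_inject) (auto simp: on_grid_def)
  then show "(cauchy_matrix s x *v special s m x) $ bnd s i j = 0"
    by (simp add: cauchy_matrix_special[OF assms(1)] axis_def)
qed (use assms in auto)

lemma lin_special_top:
  assumes "x \<in> data_space" "1 \<le> m" "m \<le> N"
  shows "lin x (special s m x) $ grid_node s m (N + 1) = 1"
proof -
  have on: "on_grid N m (N + 1)" "\<not> (1 \<le> m \<and> m \<le> N \<and> 1 \<le> N + 1 \<and> N + 1 \<le> N)" "m \<noteq> N + 1"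
    using assms by (auto simp: on_grid_def)
  have "(cauchy_matrix s x *v special s m x) $ bnd s m (N + 1) = 1"
    by (simp add: cauchy_matrix_special[OF assms(1)])
  then show ?thesis
    using lin_bnd[OF assms(1) on(1,2)]
    by (simp add: cauchy_matrix_mult[OF assms(1)] cauchy_row_other[OF on])
qed

lemma fac_neumann_special: "fac (\<lambda>x. neumann_data (fst x) (lin x (special s m x)) $ b)"
proof -
  have "fac (\<lambda>x. \<Sum>c\<in>UNIV. fst (measurement x) $ b $ c * special s m x $ c)"
    by (intro Ck_factors_sum Ck_factors_mult fac_dtn_entry fac_special)
  then show ?thesis
    by (simp add: matrix_vector_mult_def flip: linearized_dtn_mult cong: Ck_factors_cong)
qed

text \<open>The special field for \<open>m = i\<close> is 1 at the top node
  \<open>(i, N + 1)\<close> and 0 at its only neighbour \<open>(i, N)\<close>, so its Neumann datum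
  there is the conductivity itself.\<close>

lemma fac_vc_top:
  assumes "1 \<le> i" "i \<le> N"
  shows "fac (vc s i N)"
proof -
  have "vc s i N x = neumann_data (fst x) (lin x (special s i x)) $ bnd s i (N + 1)"
    if "x \<in> data_space" for x
    using lin_special_top[OF that assms, of s] lin_special_zero[OF that assms, of i N s] assms
    by (simp add: neumann_top on_grid_def)
  then show ?thesis
    using fac_neumann_special by (simp cong: Ck_factors_cong)
qed

lemma layer_eq:
  assumes "x \<in> data_space" "1 \<le> i" "i \<le> N"
  shows "v $ grid_node s i N =
    v $ grid_node s i (N + 1) - neumann_data (fst x) v $ bnd s i (N + 1) / vc s i N x"
  using vc_pos[OF assms(1), of s i N] by (simp add: neumann_top[OF assms(2,3)])

lemma fac_special_boundary:
  assumes "on_grid N i j" "\<not> (1 \<le> i \<and> i \<le> N \<and> 1 \<le> j \<and> j \<le> N)"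
  shows "fac (\<lambda>x. lin x (special s m x) $ grid_node s i j)"
  using fac_special by (simp add: lin_bnd[OF _ assms] cong: Ck_factors_cong)

lemma fac_sol_boundary:
  assumes "on_grid N i j" "\<not> (1 \<le> i \<and> i \<le> N \<and> 1 \<le> j \<and> j \<le> N)"
  shows "fac (\<lambda>x. sol x $ grid_node s i j)"
  using fac_dirichlet by (simp add: sol_bnd[OF _ assms] cong: Ck_factors_cong)

lemma corner_sweep_chart:
  "corner_sweep k measurement data_space N (hc s) (vc s) (\<lambda>i j x. sol x $ grid_node s i j)
     (\<lambda>i j x. f (grid_node s i j) (sol x $ grid_node s i j))
     (\<lambda>i j x. deriv (f (grid_node s i j)) (sol x $ grid_node s i j))
     (\<lambda>m i j x. lin x (special s m x) $ grid_node s i j)"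
proof
  show "N \<ge> 1"
    by (rule lattice_size_pos[OF N_def])
  show "hc s i j x > 0" "vc s i j x > 0" if "x \<in> data_space" for x i j
    using hc_pos vc_pos that by auto
  show "fac (\<lambda>x. lin x (special s m x) $ grid_node s i j)"
    if "on_grid N i j" "i = N + 1 \<or> j = N + 1" for m i j
    using that by (intro fac_special_boundary) auto
  show "fac (\<lambda>x. sol x $ grid_node s i j)" if "on_grid N i j" "i = N + 1 \<or> j = N + 1" for i j
    using that by (intro fac_sol_boundary) auto
  show "fac (\<lambda>x. lin x (special s m x) $ grid_node s i N)" if "1 \<le> i" "i \<le> N" for m i
  proof -
    have "fac (\<lambda>x. lin x (special s m x) $ grid_node s i (N + 1) -
        neumann_data (fst x) (lin x (special s m x)) $ bnd s i (N + 1) / vc s i N x)"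
      using that vc_pos
      by (intro Ck_factors_diff Ck_factors_divide fac_special_boundary fac_neumann_special fac_vc_top)
        (auto simp: on_grid_def less_imp_neq[symmetric])
    then show ?thesis
      by (subst Ck_factors_cong[OF layer_eq]) (use that in auto)
  qed
  show "fac (\<lambda>x. sol x $ grid_node s i N)" if "1 \<le> i" "i \<le> N" for i
  proof -
    have "fac (\<lambda>x. sol x $ grid_node s i (N + 1) -
        neumann_data (fst x) (sol x) $ bnd s i (N + 1) / vc s i N x)"
      using that vc_pos
      by (intro Ck_factors_diff Ck_factors_divide fac_sol_boundary fac_neumann fac_vc_top)
        (auto simp: on_grid_def less_imp_neq[symmetric])
    then show ?thesis
      by (subst Ck_factors_cong[OF layer_eq]) (use that in auto)
  qed
  fix i j
  assume ij: "1 \<le> i" "i \<le> N" "1 \<le> j" "j \<le> N"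
  then have inner: "(grid_node s i j :: 'n node) \<in> inner_nodes"
    by (simp add: grid_node_inner_iff[OF N_def] on_grid_def)
  assume "fac (\<lambda>x. sol x $ grid_node s i j)"
  then show "fac (\<lambda>x. f (grid_node s i j) (sol x $ grid_node s i j))"
    "fac (\<lambda>x. deriv (f (grid_node s i j)) (sol x $ grid_node s i j))"
    using Ck_factors_compose_real Ck_on_Suc_imp[OF smooth[OF inner]] smooth_deriv[OF inner] by blast+
qed (simp_all add: sol_grid lin_grid lin_special_zero lin_special_top fac_vc_top)

lemma fac_from_one: "corner_sweep.fac_from k measurement data_space N (hc s) (vc s)
    (\<lambda>i j x. sol x $ grid_node s i j) 1"
  by (rule corner_sweep.fac_from_one[OF corner_sweep_chart])

section \<open>Covering the lattice by the two charts\<close>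

lemma
  shows fac_sol_upper: "on_grid N i j \<Longrightarrow> i + j \<ge> N + 1 \<Longrightarrow> fac (\<lambda>x. sol x $ grid_node s i j)"
    and fac_hc_upper: "on_grid N i j \<Longrightarrow> on_grid N (i + 1) j \<Longrightarrow> 1 \<le> j \<Longrightarrow> j \<le> N \<Longrightarrow>
      i + j \<ge> N + 1 \<Longrightarrow> fac (hc s i j)"
    and fac_vc_upper: "on_grid N i j \<Longrightarrow> on_grid N i (j + 1) \<Longrightarrow> 1 \<le> i \<Longrightarrow> i \<le> N \<Longrightarrow>
      i + j \<ge> N + 1 \<Longrightarrow> fac (vc s i j)"
  using fac_from_one unfolding corner_sweep.fac_from_def[OF corner_sweep_chart] by blast+

lemma grid_node_reflect: "grid_node True i j = (grid_node False (N + 1 - i) (N + 1 - j) :: 'n node)"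
  by (simp add: grid_node_def N_def)

lemma fac_sol: "fac (\<lambda>x. sol x $ p)"
proof -
  obtain i j where p: "on_grid N i j" "p = grid_node True i j"
    by (rule grid_node_cases[OF N_def])
  show ?thesis
  proof (cases "i + j \<ge> N + 1")
    case True
    then show ?thesis
      using fac_sol_upper p by simp
  next
    case False
    then show ?thesis
      \<comment> \<open>Reflection replaces \<open>i + j\<close> by
        \<open>2 * (N + 1) - (i + j)\<close>, which moves nodes below the diagonal above it.\<close>
      unfolding p(2) grid_node_reflect using p(1) by (intro fac_sol_upper) (auto simp: on_grid_def)
  qed
qed

lemma fac_conductivity: "fac (\<lambda>x. fst x $ e)"
proof -
  have edge: "fst x $ e = cond (fst x) p q" if "Rep_edge e = {p, q}"
    for x :: "(real ^ 'n edge) \<times> (real ^ 'n bnode)" and p q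
    by (simp add: cond_def Rep_edge_inverse flip: that)
  show ?thesis
  proof (rule edge_cases[OF N_def Rep_edge[of e], where s = True], goal_cases)
    case (1 i j)
    have upper: "(\<lambda>x. fst x $ e) = hc True i j"
      using edge[OF 1(5)] by (simp add: hc_def fun_eq_iff)
    \<comment> \<open>Reflection exchanges the ends, so the left end is now the image of
      \<open>(i + 1, j)\<close>. Its coordinate sum \<open>2 * N + 1 - (i + j)\<close> is at least
      \<open>N + 1\<close> exactly when \<open>i + j \<le> N\<close>, the case missed by the first
      chart.\<close>
    have lower: "(\<lambda>x. fst x $ e) = hc False (N - i) (N + 1 - j)"
      using edge[OF 1(5)[THEN trans[OF _ insert_commute]]]
      by (simp add: hc_def fun_eq_iff grid_node_reflect algebra_simps)
    show ?thesis
    proof (cases "i + j \<ge> N + 1")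
      case True
      with 1 show ?thesis
        unfolding upper by (intro fac_hc_upper)
    next
      case False
      with 1 show ?thesis
        unfolding lower by (intro fac_hc_upper) (auto simp: on_grid_def)
    qed
  next
    case (2 i j)
    have upper: "(\<lambda>x. fst x $ e) = vc True i j"
      using edge[OF 2(5)] by (simp add: vc_def fun_eq_iff)
    have lower: "(\<lambda>x. fst x $ e) = vc False (N + 1 - i) (N - j)"
      using edge[OF 2(5)[THEN trans[OF _ insert_commute]]]
      by (simp add: vc_def fun_eq_iff grid_node_reflect algebra_simps)
    show ?thesis
    proof (cases "i + j \<ge> N + 1")
      case True
      with 2 show ?thesis
        unfolding upper by (intro fac_vc_upper)
    next
      case False
      with 2 show ?thesis
        unfolding lower by (intro fac_vc_upper) (auto simp: on_grid_def)
    qed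
  qed
qed

lemma reconstruction:
  obtains U R where "open U" "measurement ` data_space \<subseteq> U" "Ck_on k R U"
    "R ` U \<subseteq> UNIV \<times> conductivities" "\<And>x. x \<in> data_space \<Longrightarrow> R (measurement x) = (sol x, fst x)"
proof -
  obtain U \<rho> where U: "open U" "measurement ` data_space \<subseteq> U" "Ck_on k \<rho> U"
    "\<And>x. x \<in> data_space \<Longrightarrow> \<rho> (measurement x) = sol x"
    using Ck_factors_vec[OF fac_sol] by blast
  obtain V \<sigma> where V: "open V" "measurement ` data_space \<subseteq> V" "Ck_on k \<sigma> V"
    "\<And>x. x \<in> data_space \<Longrightarrow> \<sigma> (measurement x) = fst x"
    using Ck_factors_vec[OF fac_conductivity] by blast
  \<comment> \<open>The last preimage makes the reconstructed conductivity positive on the whole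
    domain; it is open because the positive vectors form an open set.\<close>
  let ?W = "U \<inter> (V \<inter> \<sigma> -` conductivities)"
  have "open ?W"
    using U(1) V(1,3) open_conductivities Ck_on_imp_continuous_on
    by (intro open_Int continuous_open_preimage) auto
  moreover have "Ck_on k \<rho> ?W" "Ck_on k \<sigma> ?W"
    by (rule Ck_on_subset[OF U(3)], blast) (rule Ck_on_subset[OF V(3)], blast)
  ultimately have "Ck_on k (\<lambda>y. (\<rho> y, \<sigma> y)) ?W"
    by (rule Ck_on_Pair)
  moreover have "fst x \<in> conductivities" if "x \<in> data_space" for x
    using that by (auto simp: data_space_def)
  ultimately show ?thesis
    using \<open>open ?W\<close> U V by (intro that[of ?W "\<lambda>y. (\<rho> y, \<sigma> y)"]) auto
qed

end

theorem theorem5p2: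
  fixes f :: "'n::finite node \<Rightarrow> real \<Rightarrow> real" and r :: nat
  assumes "r \<ge> 1"
    and "\<And>p. p \<in> inner_nodes \<Longrightarrow> Ck_on r (f p) UNIV"
    and "\<And>p t. p \<in> inner_nodes \<Longrightarrow> deriv (f p) t \<ge> 0"
  shows
    "(\<forall>\<gamma>\<in>conductivities. \<forall>\<gamma>'\<in>conductivities. \<forall>\<phi>.
        linearized_dtn f \<gamma> \<phi> = linearized_dtn f \<gamma>' \<phi> \<and> dtn_map f \<gamma> \<phi> = dtn_map f \<gamma>' \<phi> \<longrightarrow>
        \<gamma> = \<gamma>' \<and> solution f \<gamma> \<phi> = solution f \<gamma>' \<phi>) \<and>
     (\<forall>\<gamma>\<^sub>0\<in>conductivities. \<forall>\<phi>\<^sub>0.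
        \<exists>(U :: ((real ^ 'n bnode ^ 'n bnode) \<times> (real ^ 'n bnode) \<times> (real ^ 'n bnode)) set)
          (R :: _ \<Rightarrow> (real ^ 'n node) \<times> (real ^ 'n edge)).
          open U \<and> (linearized_dtn f \<gamma>\<^sub>0 \<phi>\<^sub>0, dtn_map f \<gamma>\<^sub>0 \<phi>\<^sub>0, \<phi>\<^sub>0) \<in> U \<and>
          Ck_on (r - 1) R U \<and> R ` U \<subseteq> UNIV \<times> conductivities \<and>
          (\<forall>\<gamma>\<in>conductivities. \<forall>\<phi>.
             (linearized_dtn f \<gamma> \<phi>, dtn_map f \<gamma> \<phi>, \<phi>) \<in> U \<longrightarrow>
             R (linearized_dtn f \<gamma> \<phi>, dtn_map f \<gamma> \<phi>, \<phi>) = (solution f \<gamma> \<phi>, \<gamma>)))"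
proof -
  interpret smooth_network f "r - 1" "int CARD('n)"
    using assms by unfold_locales auto
  \<comment> \<open>The same \<open>U\<close> and \<open>R\<close> serve every base point
    \<open>(\<gamma>\<^sub>0, \<phi>\<^sub>0)\<close>. Uniqueness follows by applying
    \<open>R\<close> to two equal triples.\<close>
  obtain U R where UR: "open U" "measurement ` data_space \<subseteq> U" "Ck_on (r - 1) R U"
    "R ` U \<subseteq> UNIV \<times> conductivities" "\<And>x. x \<in> data_space \<Longrightarrow> R (measurement x) = (sol x, fst x)"
    by (rule reconstruction) blast
  have R: "R (linearized_dtn f \<gamma> \<phi>, dtn_map f \<gamma> \<phi>, \<phi>) = (solution f \<gamma> \<phi>, \<gamma>)"
    if "\<gamma> \<in> conductivities" for \<gamma> \<phi>
    using UR(5)[of "(\<gamma>, \<phi>)"] that by (simp add: data_space_def measurement_def sol_def)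
  have U: "(linearized_dtn f \<gamma> \<phi>, dtn_map f \<gamma> \<phi>, \<phi>) \<in> U" if "\<gamma> \<in> conductivities" for \<gamma> \<phi>
    using UR(2) that by (force simp: data_space_def measurement_def)
  show ?thesis
  proof (intro conjI ballI allI)
    fix \<gamma> \<gamma>' :: "real ^ 'n edge" and \<phi> :: "real ^ 'n bnode"
    assume "\<gamma> \<in> conductivities" "\<gamma>' \<in> conductivities"
    then show "linearized_dtn f \<gamma> \<phi> = linearized_dtn f \<gamma>' \<phi> \<and> dtn_map f \<gamma> \<phi> = dtn_map f \<gamma>' \<phi> \<longrightarrow>
        \<gamma> = \<gamma>' \<and> solution f \<gamma> \<phi> = solution f \<gamma>' \<phi>"
      using R by (metis prod.inject)
  next
    fix \<gamma>\<^sub>0 :: "real ^ 'n edge" and \<phi>\<^sub>0 :: "real ^ 'n bnode"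
    assume "\<gamma>\<^sub>0 \<in> conductivities"
    then show "\<exists>U R. open U \<and> (linearized_dtn f \<gamma>\<^sub>0 \<phi>\<^sub>0, dtn_map f \<gamma>\<^sub>0 \<phi>\<^sub>0, \<phi>\<^sub>0) \<in> U \<and>
        Ck_on (r - 1) R U \<and> R ` U \<subseteq> UNIV \<times> conductivities \<and>
        (\<forall>\<gamma>\<in>conductivities. \<forall>\<phi>.
           (linearized_dtn f \<gamma> \<phi>, dtn_map f \<gamma> \<phi>, \<phi>) \<in> U \<longrightarrow>
           R (linearized_dtn f \<gamma> \<phi>, dtn_map f \<gamma> \<phi>, \<phi>) = (solution f \<gamma> \<phi>, \<gamma>))"
      using UR(1,3,4) R U by (intro exI[of _ U] exI[of _ R]) simp
  qed
qed

end
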